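(* Let $G$ be a finite simple graph. If $G$ contains $K_{134,12}$ as an induced minor, then $G$ contains a cycle of length at most $12$ or a theta as an induced subgraph.
   Context: $K_{a,b}$ is the complete bipartite graph with sides of sizes $a$ and $b$. A graph $H$ is an induced minor of $G$ if $H$ can be obtained from $G$ by repeatedly deleting vertices and contracting edges. A theta is a graph made of three internally vertex-disjoint chordless paths $P_1=a\dots b$, $P_2=a\dots b$, $P_3=a\dots b$, each of length (number of edges) at least two, such that no edges exist between the paths except the three edges incident to $a$ and the three edges incident to $b$. *)

theory Defs
  imports "Graph_Theory.Graph_Theory"
begin

text \<open>
  A finite simple graph is a \<open>pair_graph\<close>: a finite, loop-free, symmetric set of ordered pairs, so
  the edge \<open>uv\<close> is present as the two arcs \<open>(u, v)\<close> and \<open>(v, u)\<close>.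
\<close>

section \<open>Induced minors\<close>

definition delete_vertex :: "'a pair_pre_digraph \<Rightarrow> 'a \<Rightarrow> 'a pair_pre_digraph" where
  "delete_vertex G v = \<lparr>
     pverts = pverts G - {v},
     parcs = {(x, y) \<in> parcs G. x \<noteq> v \<and> y \<noteq> v} \<rparr>"

text \<open>
  Contraction of the edge \<open>uv\<close>: the vertex resulting from the identification of \<open>u\<close> and \<open>v\<close> keeps
  the name \<open>u\<close>. Loops are discarded, and parallel edges are merged because the arcs form a set.
\<close>

definition contract_edge :: "'a pair_pre_digraph \<Rightarrow> 'a \<Rightarrow> 'a \<Rightarrow> 'a pair_pre_digraph" where
  "contract_edge G u v = (let f = (\<lambda>x. if x = v then u else x) in \<lparr>
     pverts = pverts G - {v},
     parcs = {(f x, f y) | x y. (x, y) \<in> parcs G \<and> f x \<noteq> f y} \<rparr>)"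

text \<open>
  \<open>induced_minor H G\<close> holds for the concrete graphs \<open>H\<close> produced by sequences of operations on \<open>G\<close>;
  it is not closed under isomorphism, so it is to be combined with an isomorphism-invariant
  property of \<open>H\<close>.
\<close>

inductive induced_minor :: "'a pair_pre_digraph \<Rightarrow> 'a pair_pre_digraph \<Rightarrow> bool" where
  refl: "induced_minor G G"
| delete: "induced_minor H G \<Longrightarrow> v \<in> pverts H \<Longrightarrow> induced_minor (delete_vertex H v) G"
| contract: "induced_minor H G \<Longrightarrow> (u, v) \<in> parcs H \<Longrightarrow> induced_minor (contract_edge H u v) G"

section \<open>Cycles and thetas\<close>

text \<open>
  The bound \<open>3 \<le> n\<close> excludes the closed walk \<open>u, v, u\<close> along a single edge, which the library
  accepts as a \<open>cycle\<close> of a symmetric digraph.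
\<close>

definition cycle_graph :: "nat \<Rightarrow> 'a pair_pre_digraph \<Rightarrow> bool" where
  "cycle_graph n H \<longleftrightarrow> pair_graph H \<and> 3 \<le> n \<and>
     (\<exists>p. pre_digraph.cycle (with_proj H) p \<and> length p = n \<and>
          pverts H = fst ` set p \<and> parcs H = set p \<union> (set p)\<inverse>)"

definition chordless :: "'a vwalk \<Rightarrow> 'a pair_pre_digraph \<Rightarrow> bool" where
  "chordless p H \<longleftrightarrow>
     (\<forall>i < length p. \<forall>j < length p. (p ! i, p ! j) \<in> parcs H \<longrightarrow> i = Suc j \<or> j = Suc i)"

text \<open>
  In the last conjunct, \<open>P k ! 1\<close> and \<open>last (butlast (P k))\<close> are the second and the penultimate
  vertex of the \<open>k\<close>-th path, so the edges listed there are the three edges incident to \<open>a\<close> and the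
  three edges incident to \<open>b\<close>. They join different paths in the sense of that conjunct because \<open>a\<close>
  and \<open>b\<close> lie on all three paths.
\<close>

definition theta_graph :: "'a pair_pre_digraph \<Rightarrow> bool" where
  "theta_graph H \<longleftrightarrow> pair_graph H \<and>
     (\<exists>a b. \<exists>P :: nat \<Rightarrow> 'a vwalk.
        (\<forall>k < 3. vpath (P k) (with_proj H) \<and> hd (P k) = a \<and> last (P k) = b \<and>
                 2 \<le> vwalk_length (P k) \<and> chordless (P k) H) \<and>
        (\<forall>i < 3. \<forall>j < 3. i \<noteq> j \<longrightarrow> set (P i) \<inter> set (P j) = {a, b}) \<and>
        pverts H = (\<Union>k < 3. set (P k)) \<and>
        (\<forall>i < 3. \<forall>j < 3. i \<noteq> j \<longrightarrow>
           (\<forall>x \<in> set (P i). \<forall>y \<in> set (P j). (x, y) \<in> parcs H \<longrightarrow>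
              (\<exists>k < 3. {x, y} = {a, P k ! 1} \<or> {x, y} = {last (butlast (P k)), b}))))"

end

(*
  Two disjoint connected sets X and Y without edges between them, joined by three disjoint
  connected sets Z_1, Z_2, Z_3 without edges between them, nearly force an induced theta: in a
  triangle-free graph both X and Y supply the centre of a subdivided claw towards the Z_i, and the
  two centres are the ends of a theta. The only way out is that some Z_i contains a vertex or an
  edge touching both X and Y, one end of which has two neighbours in X or in Y (it then serves as
  a centre itself, and a path of the theta may become too short).

  In a model of the biclique, let B_1, ..., B_5 be branch sets of one side. For two of them, all
  but two of the branch sets of the other side contain a vertex or an edge touching both. If a
  branch set A has this property for all ten pairs but no connected subset with at most four
  vertices touches three of the B_j, then the ten links are pairwise disjoint and anticomplete, and
  the three connections of B_1 with B_2 through B_3, B_4 and B_5 contradict the first paragraph. So,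
  among 65 branch sets A, two contain connected subsets with at most four vertices that touch the
  same three B_j, and then the vertex with two neighbours of the first paragraph lies on a
  cycle of length at most five.
*)
theory Submission
  imports Defs
begin

section \<open>Connectivity expressed by cuts, non-cut vertices, and induced paths\<close>

section \<open>Connected sets and induced paths\<close>

locale simple_adjacency =
  fixes E :: "'a \<Rightarrow> 'a \<Rightarrow> bool"
  assumes E_sym: "E x y \<Longrightarrow> E y x"
    and E_irrefl: "\<not> E x x"
begin

definition touch :: "'a set \<Rightarrow> 'a set \<Rightarrow> bool" where
  "touch A B \<longleftrightarrow> (\<exists>a\<in>A. \<exists>b\<in>B. E a b)"

definition sep :: "'a set \<Rightarrow> 'a set \<Rightarrow> bool" where
  "sep A B \<longleftrightarrow> A \<inter> B = {} \<and> \<not> touch A B"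

text \<open>Connectivity in terms of cuts rather than walks, which makes unions and extensions by a
  vertex direct. Finiteness is built in for the inductions on cardinality.\<close>

definition conn :: "'a set \<Rightarrow> bool" where
  "conn S \<longleftrightarrow> finite S \<and> S \<noteq> {} \<and> (\<forall>U. U \<subset> S \<longrightarrow> U \<noteq> {} \<longrightarrow> touch U (S - U))"

text \<open>For connected \<open>X\<close> and \<open>s\<close> outside it, this yields a cycle
  through \<open>s\<close> with at most \<open>Suc (card X)\<close> vertices; the absence of short
  cycles is used in this form.\<close>

definition two_nbrs :: "'a \<Rightarrow> 'a set \<Rightarrow> bool" where
  "two_nbrs s X \<longleftrightarrow> (\<exists>u\<in>X. \<exists>v\<in>X. u \<noteq> v \<and> E s u \<and> E s v)"

text \<open>An induced path: the equivalence encodes consecutive adjacency and the absence of chords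
  at once.\<close>

definition ipath :: "'a list \<Rightarrow> bool" where
  "ipath p \<longleftrightarrow> p \<noteq> [] \<and> distinct p \<and>
     (\<forall>i < length p. \<forall>j < length p. E (p ! i) (p ! j) \<longleftrightarrow> i = Suc j \<or> j = Suc i)"

lemma touch_sym: "touch A B \<Longrightarrow> touch B A"
  unfolding touch_def using E_sym by blast

lemma sep_sym: "sep A B \<Longrightarrow> sep B A"
  unfolding sep_def using touch_sym by blast

lemma sep_mono: "sep A B \<Longrightarrow> A' \<subseteq> A \<Longrightarrow> B' \<subseteq> B \<Longrightarrow> sep A' B'"
  unfolding sep_def touch_def by blast

lemma connD: "conn S \<Longrightarrow> finite S" "conn S \<Longrightarrow> S \<noteq> {}"
  "conn S \<Longrightarrow> U \<subset> S \<Longrightarrow> U \<noteq> {} \<Longrightarrow> touch U (S - U)"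
  unfolding conn_def by auto

lemma conn_singleton: "conn {x}"
  unfolding conn_def by (auto simp: psubset_eq subset_singleton_iff)

lemma conn_Un:
  assumes "conn S" "conn T" "S \<inter> T \<noteq> {} \<or> touch S T"
  shows "conn (S \<union> T)"
  unfolding conn_def
proof (intro conjI allI impI)
  fix U assume U: "U \<subset> S \<union> T" "U \<noteq> {}"
  consider "U \<inter> S \<noteq> {}" "\<not> S \<subseteq> U" | "U \<inter> T \<noteq> {}" "\<not> T \<subseteq> U"
    | "S \<subseteq> U" "U \<inter> T = {}" | "T \<subseteq> U" "U \<inter> S = {}"
    using U by blast
  then show "touch U (S \<union> T - U)"
  proof cases
    case 1
    then have "touch (U \<inter> S) (S - U \<inter> S)" by (intro connD(3)[OF assms(1)]) auto
    then show ?thesis unfolding touch_def by blast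
  next
    case 2
    then have "touch (U \<inter> T) (T - U \<inter> T)" by (intro connD(3)[OF assms(2)]) auto
    then show ?thesis unfolding touch_def by blast
  next
    case 3
    then have "touch S T" using assms(1,3) connD(2) by blast
    then show ?thesis using 3 unfolding touch_def by blast
  next
    case 4
    then have "touch T S" using assms(2,3) connD(2) touch_sym by blast
    then show ?thesis using 4 unfolding touch_def by blast
  qed
qed (use assms connD in auto)

lemma conn_insert: "conn S \<Longrightarrow> touch {v} S \<Longrightarrow> conn (insert v S)"
  using conn_Un[OF conn_singleton, of S v] by simp

lemma conn_edge: "E u v \<Longrightarrow> conn {u, v}"
  by (intro conn_insert conn_singleton) (simp add: touch_def)

text \<open>A maximal connected proper subset containing \<open>z\<close> can be extended by a
  neighbour, and by maximality the extension is all of \<open>S\<close>; so exactly one vertex was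
  missing, and it differs from \<open>z\<close>.\<close>

lemma exists_noncut_vertex:
  assumes "conn S" "z \<in> S" "S \<noteq> {z}"
  obtains y where "y \<in> S" "y \<noteq> z" "conn (S - {y})"
proof -
  define P where "P U \<longleftrightarrow> conn U \<and> z \<in> U \<and> U \<subset> S" for U
  have fin: "finite {U. P U}"
    by (rule finite_subset[of _ "Pow S"]) (auto simp: P_def connD(1)[OF assms(1)])
  have "P {z}" using assms by (auto simp: P_def conn_singleton)
  then obtain U where U: "P U" and max: "\<And>V. P V \<Longrightarrow> U \<subseteq> V \<Longrightarrow> U = V"
    using finite_has_maximal[OF fin] by blast
  obtain a y where ay: "a \<in> U" "y \<in> S - U" "E a y"
    using connD(3)[OF assms(1), of U] U unfolding P_def touch_def by blast
  have "conn (insert y U)"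
    using U ay(1) E_sym[OF ay(3)] unfolding P_def touch_def by (intro conn_insert) (auto simp: touch_def)
  then have "insert y U = S"
    using max[of "insert y U"] U ay unfolding P_def by blast
  then have "S - {y} = U" using ay by blast
  then show ?thesis using that[of y] U ay unfolding P_def by blast
qed

lemma ipathD: "ipath p \<Longrightarrow> p \<noteq> []" "ipath p \<Longrightarrow> distinct p"
  "ipath p \<Longrightarrow> i < length p \<Longrightarrow> j < length p \<Longrightarrow> E (p ! i) (p ! j) \<longleftrightarrow> i = Suc j \<or> j = Suc i"
  unfolding ipath_def by auto

lemma ipath_take: "ipath p \<Longrightarrow> 0 < n \<Longrightarrow> ipath (take n p)"
  unfolding ipath_def by auto

lemma ipath_drop: "ipath p \<Longrightarrow> n < length p \<Longrightarrow> ipath (drop n p)"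
  unfolding ipath_def by auto

lemma ipath_singleton: "ipath [x]"
  unfolding ipath_def by (simp add: E_irrefl)

lemma ipath_Cons:
  assumes "ipath p" "x \<notin> set p" "\<And>i. i < length p \<Longrightarrow> E x (p ! i) \<longleftrightarrow> i = 0"
  shows "ipath (x # p)"
  unfolding ipath_def
proof (intro conjI allI impI)
  fix i j assume "i < length (x # p)" "j < length (x # p)"
  moreover have "E (p ! i) x \<longleftrightarrow> i = 0" if "i < length p" for i
    using assms(3)[OF that] E_sym by blast
  ultimately show "E ((x # p) ! i) ((x # p) ! j) \<longleftrightarrow> i = Suc j \<or> j = Suc i"
    using assms(3) ipathD(3)[OF assms(1)] by (cases i; cases j) (auto simp: E_irrefl)
qed (use assms ipathD in auto)

lemma ipath_rev: "ipath p \<Longrightarrow> ipath (rev p)"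
  unfolding ipath_def by (auto simp: rev_nth)

lemma ipath_snoc:
  assumes "ipath p" "x \<notin> set p" "\<And>i. i < length p \<Longrightarrow> E x (p ! i) \<longleftrightarrow> i = length p - 1"
  shows "ipath (p @ [x])"
proof -
  have "E x (rev p ! i) \<longleftrightarrow> i = 0" if "i < length (rev p)" for i
    using assms(3)[of "length p - Suc i"] that by (auto simp: rev_nth)
  then have "ipath (x # rev p)"
    using assms by (intro ipath_Cons ipath_rev) auto
  then show ?thesis using ipath_rev by fastforce
qed

lemma ipath_conn: "ipath p \<Longrightarrow> conn (set p)"
proof (induction p)
  case Nil
  then show ?case by (simp add: ipath_def)
next
  case (Cons x p)
  show ?case
  proof (cases "p = []")
    case True
    then show ?thesis by (simp add: conn_singleton)
  next
    case False
    have "E x (p ! 0)" using ipathD(3)[OF Cons.prems, of 0 1] False by simp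
    then have "touch {x} (set p)" using False unfolding touch_def by fastforce
    moreover have "ipath p" using ipath_drop[OF Cons.prems, of 1] False by simp
    ultimately show ?thesis using Cons.IH by (simp add: conn_insert)
  qed
qed

text \<open>\<open>A\<close> and \<open>B\<close> are arbitrary properties so that the induction on
  \<open>card S\<close> can change them: when the removed non-cut vertex \<open>y\<close> is the
  only one with property \<open>A\<close>, the rest is searched for a path whose only neighbour of
  \<open>y\<close> is its first vertex, and \<open>y\<close> is prepended; symmetrically for
  \<open>B\<close>.\<close>

lemma induced_path_between:
  assumes "conn S" "\<exists>a\<in>S. A a" "\<exists>b\<in>S. B b"
  obtains p where "ipath p" "set p \<subseteq> S"
    "\<And>i. i < length p \<Longrightarrow> A (p ! i) \<longleftrightarrow> i = 0"
    "\<And>i. i < length p \<Longrightarrow> B (p ! i) \<longleftrightarrow> i = length p - 1"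
proof -
  have "\<exists>p. ipath p \<and> set p \<subseteq> S \<and> (\<forall>i < length p. A (p ! i) \<longleftrightarrow> i = 0) \<and>
      (\<forall>i < length p. B (p ! i) \<longleftrightarrow> i = length p - 1)"
    using assms
  proof (induction "card S" arbitrary: S A B rule: less_induct)
    case less
    obtain z where z: "z \<in> S" using less.prems by blast
    show ?case
    proof (cases "S = {z}")
      case True
      then show ?thesis using less.prems by (intro exI[of _ "[z]"]) (auto simp: ipath_singleton)
    next
      case False
      then obtain y where y: "y \<in> S" "y \<noteq> z" "conn (S - {y})"
        using exists_noncut_vertex[OF less.prems(1) z] by blast
      have card: "card (S - {y}) < card S"
        using y connD(1)[OF less.prems(1)] by (meson card_Diff1_less)
      have "touch {y} (S - {y})"
        using connD(3)[OF less.prems(1), of "{y}"] y z by blast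
      then have nb: "\<exists>x\<in>S - {y}. E y x" unfolding touch_def by blast
      have A: "A y" if "\<not> (\<exists>a\<in>S - {y}. A a)" using less.prems(2) that by auto
      have B: "B y" if "\<not> (\<exists>b\<in>S - {y}. B b)" using less.prems(3) that by auto
      consider (1) "(\<exists>a\<in>S - {y}. A a) \<and> (\<exists>b\<in>S - {y}. B b)" | (2) "A y \<and> B y"
        | (3) "A y \<and> \<not> B y \<and> \<not> (\<exists>a\<in>S - {y}. A a)"
        | (4) "B y \<and> \<not> A y \<and> \<not> (\<exists>b\<in>S - {y}. B b)"
        using A B by metis
      then show ?thesis
      proof cases
        case 1
        then obtain p where "ipath p" "set p \<subseteq> S - {y}"
          "\<forall>i < length p. A (p ! i) \<longleftrightarrow> i = 0" "\<forall>i < length p. B (p ! i) \<longleftrightarrow> i = length p - 1"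
          using less.hyps[OF card y(3), of A B] by auto
        then show ?thesis by (intro exI[of _ p]) auto
      next
        case 2
        then show ?thesis using y by (intro exI[of _ "[y]"]) (auto simp: ipath_singleton)
      next
        case 3
        then have "\<exists>b\<in>S - {y}. B b" using less.prems by blast
        with less.hyps[OF card y(3) nb, of B] obtain p where p: "ipath p" "set p \<subseteq> S - {y}"
          "\<forall>i < length p. E y (p ! i) \<longleftrightarrow> i = 0" "\<forall>i < length p. B (p ! i) \<longleftrightarrow> i = length p - 1"
          by auto
        have "ipath (y # p)" using p by (intro ipath_Cons) auto
        moreover have "\<not> A (p ! i)" if "i < length p" for i using 3 p(2) that nth_mem by blast
        ultimately show ?thesis using 3 p y(1) ipathD(1)[OF p(1)]
          by (intro exI[of _ "y # p"]) (auto simp: nth_Cons split: nat.split)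
      next
        case 4
        then have "\<exists>b\<in>S - {y}. A b" using less.prems by blast
        with less.hyps[OF card y(3) _ nb, of A] obtain p where p: "ipath p" "set p \<subseteq> S - {y}"
          "\<forall>i < length p. A (p ! i) \<longleftrightarrow> i = 0" "\<forall>i < length p. E y (p ! i) \<longleftrightarrow> i = length p - 1"
          by auto
        have "ipath (p @ [y])" using p by (intro ipath_snoc) auto
        moreover have "\<not> B (p ! i)" if "i < length p" for i using 4 p(2) that nth_mem by blast
        ultimately show ?thesis using 4 p y(1) ipathD(1)[OF p(1)]
          by (intro exI[of _ "p @ [y]"]) (auto simp: nth_append)
      qed
    qed
  qed
  then show ?thesis using that by blast
qed

section \<open>Subdivided claws with three prescribed ends\<close>

section \<open>Subdivided claws\<close>

text \<open>
  The sets \<open>F i\<close> are the legs of a subdivided claw with centre \<open>c\<close>, the leg \<open>F i\<close> ending in \<open>s i\<close>.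
  A vertex \<open>s k\<close> with two neighbours in \<open>X\<close> may be the centre; then its own leg is empty.
\<close>

definition tripod :: "'a set \<Rightarrow> 'i set \<Rightarrow> ('i \<Rightarrow> 'a) \<Rightarrow> 'a \<Rightarrow> ('i \<Rightarrow> 'a set) \<Rightarrow> bool" where
  "tripod X I s c F \<longleftrightarrow>
     (c \<in> X \<or> (\<exists>k\<in>I. c = s k \<and> two_nbrs (s k) X)) \<and>
     (\<forall>i\<in>I. F i \<subseteq> insert (s i) X - {c} \<and>
        (s i \<in> F i \<and> conn (F i) \<and> touch {c} (F i) \<or> F i = {} \<and> s i = c)) \<and>
     (\<forall>i\<in>I. \<forall>j\<in>I. i \<noteq> j \<longrightarrow> sep (F i) (F j))"

lemma touch_mono: "touch A B \<Longrightarrow> A \<subseteq> A' \<Longrightarrow> B \<subseteq> B' \<Longrightarrow> touch A' B'"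
  unfolding touch_def by blast

lemma two_nbrs_mono: "two_nbrs s X \<Longrightarrow> X \<subseteq> Y \<Longrightarrow> two_nbrs s Y"
  unfolding two_nbrs_def by blast

lemma touch_insert_right: "touch A (insert x B) \<longleftrightarrow> (\<exists>a\<in>A. E a x) \<or> touch A B"
  unfolding touch_def by blast

lemma touch_empty [simp]: "\<not> touch {} B" "\<not> touch A {}"
  unfolding touch_def by auto

lemma touch_singletons [simp]: "touch {x} {y} \<longleftrightarrow> E x y"
  unfolding touch_def by simp

lemma sep_insert_left: "sep (insert x A) B \<longleftrightarrow> x \<notin> B \<and> \<not> touch {x} B \<and> sep A B"
  unfolding sep_def touch_def by auto

lemma sep_empty [simp]: "sep {} B" "sep A {}"
  unfolding sep_def by auto

text \<open>
  Induction on \<open>X\<close>: if removing a non-cut vertex \<open>v\<close> isolates \<open>s i\<close> from \<open>X\<close>, then \<open>v\<close> is the only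
  neighbour of \<open>s i\<close> in \<open>X\<close> and takes over the role of \<open>s i\<close>, unless it is adjacent to a further \<open>s j\<close>.
  In that last case \<open>v\<close> or \<open>s j\<close> is the centre.
\<close>

lemma exists_tripod:
  assumes triangle_free: "\<And>x y z. E x y \<Longrightarrow> E y z \<Longrightarrow> \<not> E x z"
    and "conn X" "card I = 3" "inj_on s I"
    and "\<And>i. i \<in> I \<Longrightarrow> s i \<notin> X" "\<And>i. i \<in> I \<Longrightarrow> touch {s i} X"
    and "\<And>i j. i \<in> I \<Longrightarrow> j \<in> I \<Longrightarrow> \<not> E (s i) (s j)"
  shows "\<exists>c F. tripod X I s c F"
  using assms(2-)
proof (induction "card X" arbitrary: X s rule: less_induct)
  case less
  note X = less.prems(1) and inj = less.prems(3) and out = less.prems(4)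
    and tch = less.prems(5) and indep = less.prems(6)
  show ?case
  proof (cases "\<exists>v\<in>X. \<forall>i\<in>I. E (s i) v")
    case True
    then obtain v where v: "v \<in> X" "\<forall>i\<in>I. E (s i) v" by blast
    have "tripod X I s v (\<lambda>i. {s i})"
      unfolding tripod_def
    proof (intro conjI ballI impI)
      fix i j assume "i \<in> I" "j \<in> I" "i \<noteq> j"
      then show "sep {s i} {s j}"
        using inj indep by (auto simp: sep_def dest: inj_onD)
    qed (use v out E_sym conn_singleton in auto)
    then show ?thesis by blast
  next
    case no_star: False
    obtain z where z: "z \<in> X" using connD(2)[OF X] by blast
    have "X \<noteq> {z}"
      using no_star tch by (auto simp: touch_def)
    then obtain v where v: "v \<in> X" "conn (X - {v})"
      using exists_noncut_vertex[OF X z] by blast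
    define X' where "X' = X - {v}"
    have X': "conn X'" "X' \<subseteq> X" "v \<notin> X'" "X = insert v X'" using v by (auto simp: X'_def)
    have card: "card X' < card X"
      using v connD(1)[OF X] by (metis X'_def card_Diff1_less)
    have vX': "touch {v} X'"
      using connD(3)[OF X, of "{v}"] v connD(2)[OF X'(1)] by (auto simp: X'_def)
    show ?thesis
    proof (cases "\<forall>i\<in>I. touch {s i} X'")
      case True
      then obtain c F where "tripod X' I s c F"
        using less.hyps[OF card X'(1) less.prems(2) inj] out indep X'(2) by blast
      then have "tripod X I s c F"
        using X'(2) two_nbrs_mono[OF _ X'(2)] unfolding tripod_def by blast
      then show ?thesis by blast
    next
      case False
      then obtain i where i: "i \<in> I" "\<not> touch {s i} X'" by blast
      have iv: "E (s i) v" using tch[OF i(1)] i(2) X'(4) unfolding touch_def by blast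
      show ?thesis
      proof (cases "\<forall>j\<in>I - {i}. \<not> E (s j) v")
        case True
        \<comment> \<open>\<open>v\<close> replaces \<open>s i\<close>; the leg obtained for
          \<open>v\<close> in \<open>X'\<close> is afterwards prolonged by \<open>s i\<close>. The
          other \<open>s j\<close> still touch \<open>X'\<close>, as they are not adjacent to
          \<open>v\<close>.\<close>
        define s' where "s' = s(i := v)"
        have s': "s' i = v" "\<And>j. j \<noteq> i \<Longrightarrow> s' j = s j" by (auto simp: s'_def)
        have tch': "touch {s j} X'" if "j \<in> I" "j \<noteq> i" for j
          using tch[OF that(1)] True that X'(4) unfolding touch_def by blast
        have "inj_on s' I"
          using inj out v(1) unfolding inj_on_def s'_def by (metis fun_upd_apply)
        moreover have "s' j \<notin> X'" if "j \<in> I" for j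
          using that out X' by (cases "j = i") (auto simp: s')
        moreover have "touch {s' j} X'" if "j \<in> I" for j
          using that vX' tch' by (cases "j = i") (auto simp: s')
        moreover have "\<not> E (s' j) (s' k)" if "j \<in> I" "k \<in> I" for j k
          using that indep True E_irrefl by (cases "j = i"; cases "k = i") (auto simp: s' dest: E_sym)
        ultimately obtain c F' where "tripod X' I s' c F'"
          using less.hyps[OF card X'(1) less.prems(2), of s'] by blast
        then have c: "c \<in> X' \<or> (\<exists>k\<in>I. c = s' k \<and> two_nbrs (s' k) X')"
          and F': "\<And>j. j \<in> I \<Longrightarrow> F' j \<subseteq> insert (s' j) X' - {c}"
            "\<And>j. j \<in> I \<Longrightarrow> s' j \<in> F' j \<and> conn (F' j) \<and> touch {c} (F' j) \<or> F' j = {} \<and> s' j = c"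
          and sepF': "\<And>j k. j \<in> I \<Longrightarrow> k \<in> I \<Longrightarrow> j \<noteq> k \<Longrightarrow> sep (F' j) (F' k)"
          unfolding tripod_def by blast+
        define F where "F = F'(i := insert (s i) (F' i))"
        have F: "F i = insert (s i) (F' i)" "\<And>j. j \<noteq> i \<Longrightarrow> F j = F' j"
          by (auto simp: F_def)
        \<comment> \<open>The centre may be \<open>s' i = v\<close>, but this vertex lies in
          \<open>X\<close>; hence \<open>s i\<close> itself is never the centre.\<close>
        have c': "c \<in> X \<or> (\<exists>k\<in>I - {i}. c = s k \<and> two_nbrs (s k) X)"
        proof (cases "c \<in> X")
          case False
          then obtain k where "k \<in> I" "c = s' k" "two_nbrs (s' k) X'" using c X'(2) by blast
          moreover from this have "k \<noteq> i" using False v(1) by (auto simp: s')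
          ultimately show ?thesis using two_nbrs_mono[OF _ X'(2)] by (auto simp: s')
        qed simp
        have ci: "s i \<noteq> c" using c' out[OF i(1)] inj i(1) unfolding inj_on_def by blast
        have sepi: "sep (insert (s i) (F' i)) (F' j)" if "j \<in> I" "j \<noteq> i" for j
        proof -
          have sub: "F' j \<subseteq> insert (s j) X'" using F'(1)[OF that(1)] that(2) by (auto simp: s')
          have "s i \<notin> insert (s j) X'"
            using out[OF i(1)] X'(2) inj i(1) that by (auto dest: inj_onD)
          moreover have "\<not> touch {s i} (insert (s j) X')"
            using i(2) indep[OF i(1) that(1)] by (simp add: touch_insert_right)
          ultimately show ?thesis
            using sepF'[OF i(1) that(1)] that(2) sub touch_mono[OF _ subset_refl sub]
            by (auto simp: sep_insert_left)
        qed
        have "tripod X I s c F"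
          unfolding tripod_def
        proof (intro conjI ballI impI)
          show "c \<in> X \<or> (\<exists>k\<in>I. c = s k \<and> two_nbrs (s k) X)" using c' by blast
        next
          fix j assume j: "j \<in> I"
          show "F j \<subseteq> insert (s j) X - {c}"
            using F'(1)[OF j] X'(2) v(1) ci by (cases "j = i") (auto simp: F s')
          show "s j \<in> F j \<and> conn (F j) \<and> touch {c} (F j) \<or> F j = {} \<and> s j = c"
          proof (cases "j = i")
            case True
            have "conn (insert (s i) (F' i)) \<and> touch {c} (insert (s i) (F' i))"
            proof (cases "F' i = {}")
              case True
              then have "v = c" using F'(2)[OF i(1)] by (auto simp: s')
              then show ?thesis using True E_sym[OF iv] by (simp add: conn_singleton)
            next
              case False
              then have *: "v \<in> F' i" "conn (F' i)" "touch {c} (F' i)"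
                using F'(2)[OF i(1)] by (auto simp: s')
              then have "touch {s i} (F' i)" using iv unfolding touch_def by blast
              then show ?thesis using * by (simp add: conn_insert touch_insert_right)
            qed
            then show ?thesis by (simp add: True F)
          next
            case False
            then show ?thesis using F'(2)[OF j] by (simp add: F s')
          qed
        next
          fix j k assume jk: "j \<in> I" "k \<in> I" "j \<noteq> k"
          then show "sep (F j) (F k)"
            using sepi sepF' sep_sym by (cases "j = i"; cases "k = i") (auto simp: F)
        qed
        then show ?thesis by blast
      next
        case False
        then obtain j where j: "j \<in> I" "j \<noteq> i" "E (s j) v" by blast
        obtain k where k: "k \<in> I" "\<not> E (s k) v" using no_star v(1) by blast
        have ki: "k \<noteq> i" and kj: "k \<noteq> j" using k iv j by auto
        have I: "I = {i, j, k}"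
        proof (rule sym, rule card_subset_eq)
          show "finite I" using less.prems(2) card.infinite by fastforce
          show "card {i, j, k} = card I" using less.prems(2) ki kj j(2) by simp
        qed (use i j k in auto)
        have tk: "touch {s k} X'" using tch[OF k(1)] k(2) X'(4) unfolding touch_def by blast
        \<comment> \<open>The leg of \<open>s k\<close> will be \<open>insert (s k) K\<close> for a
          smallest such \<open>K\<close>; the last condition lets it end at either candidate for the
          centre, \<open>v\<close> or \<open>s j\<close>.\<close>
        define Q where "Q K \<longleftrightarrow> conn K \<and> K \<subseteq> X' \<and> touch {s k} K \<and> (touch {v} K \<or> touch {s j} K)" for K
        have "Q X'" using X' tk vX' by (simp add: Q_def)
        then obtain K where K: "Q K" and minK: "\<And>L. Q L \<Longrightarrow> card K \<le> card L"
          using arg_min_nat_lemma[of Q X' card] by blast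
        have KX: "conn K" "K \<subseteq> X'" "touch {s k} K" using K by (auto simp: Q_def)
        have ne: "s i \<noteq> s j" "s i \<noteq> s k" "s j \<noteq> s k"
          using inj i(1) j k(1) ki kj by (auto dest: inj_onD)
        have nK: "s i \<notin> K" "s j \<notin> K" "s k \<notin> K" "v \<notin> K" "v \<noteq> s i" "v \<noteq> s j" "v \<noteq> s k"
          using out i(1) j(1) k(1) KX(2) X' by auto
        have niK: "\<not> touch {s i} K" using i(2) touch_mono[OF _ subset_refl KX(2)] by blast
        have ind: "\<not> E (s i) (s j)" "\<not> E (s i) (s k)" "\<not> E (s j) (s k)" "\<not> E v (s k)"
          "\<not> E (s j) (s i)" "\<not> E (s k) (s i)" "\<not> E (s k) (s j)"
          using indep i(1) j(1) k E_sym by blast+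
        have cK: "conn (insert (s k) K)" using KX by (simp add: conn_insert)
        define FF where "FF A B = (\<lambda>l. if l = i then A else if l = j then B else insert (s k) K)"
          for A B
        have FF: "FF A B i = A" "FF A B j = B" "FF A B k = insert (s k) K" for A B
          using ki kj j(2) by (auto simp: FF_def)
        show ?thesis
        proof (cases "touch {s j} K")
          \<comment> \<open>Here \<open>v\<close> is the centre: its neighbours \<open>s i\<close>
            and \<open>s j\<close> form legs by themselves, and \<open>K\<close> leads to
            \<open>s k\<close>.\<close>
          case False
          then have vK: "touch {v} K" using K by (simp add: Q_def)
          have "sep {s i} {s j}" "sep {s i} (insert (s k) K)" "sep {s j} (insert (s k) K)"
            using ne ind nK niK False by (auto simp: sep_def touch_insert_right)
          then have "tripod X I s v (FF {s i} {s j})"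
            unfolding tripod_def I using v(1) KX X' vK nK cK E_sym[OF iv] E_sym[OF j(3)] j(2) ki kj
            by (auto simp: FF conn_singleton touch_insert_right sep_sym)
          then show ?thesis by blast
        next
          case True
          then obtain w where w: "w \<in> K" "E (s j) w" unfolding touch_def by blast
          \<comment> \<open>If \<open>v\<close> had a neighbour \<open>u\<close> in
            \<open>K\<close>, triangle-freeness would give \<open>u \<noteq> w\<close>. A non-cut
            vertex \<open>y\<close> of \<open>K\<close> other than the neighbour \<open>z\<close> of
            \<open>s k\<close> could then be dropped, since \<open>u\<close> or \<open>w\<close>
            remains; this contradicts minimality.\<close>
          have nvK: "\<not> touch {v} K"
          proof
            assume "touch {v} K"
            then obtain u where u: "u \<in> K" "E v u" unfolding touch_def by blast
            have uw: "u \<noteq> w" using triangle_free[OF j(3) u(2)] w(2) by blast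
            obtain z where z: "z \<in> K" "E (s k) z" using KX(3) unfolding touch_def by blast
            obtain y where y: "y \<in> K" "y \<noteq> z" "conn (K - {y})"
              using exists_noncut_vertex[OF KX(1) z(1)] u(1) w(1) uw by blast
            have "touch {v} (K - {y}) \<or> touch {s j} (K - {y})"
              using u w uw unfolding touch_def by blast
            moreover have "touch {s k} (K - {y})" using z y unfolding touch_def by blast
            ultimately have "Q (K - {y})" using y KX(2) unfolding Q_def by blast
            then show False using minK y(1) connD(1)[OF KX(1)]
              by (meson card_Diff1_less leD)
          qed
          have "two_nbrs (s j) X"
            unfolding two_nbrs_def using w j(3) nK(4) v(1) KX(2) X'(2)
            by (intro bexI[of _ v] bexI[of _ w]) auto
          moreover have "sep {s i, v} (insert (s k) K)"
            using ne ind nK niK nvK by (simp add: sep_def touch_def)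
          moreover have "conn {s i, v}" using conn_edge[OF iv] .
          \<comment> \<open>\<open>s j\<close> becomes the centre, with neighbours \<open>v\<close>
            and \<open>w\<close> in \<open>X\<close>; its own leg is empty and \<open>s i\<close> is
            reached through \<open>v\<close>.\<close>
          ultimately have "tripod X I s (s j) (FF {s i, v} {})"
            unfolding tripod_def I using v(1) KX X' True nK cK j(2,3) ki kj ne out[OF j(1)]
            by (auto simp: FF touch_insert_right sep_sym)
          then show ?thesis by blast
        qed
      qed
    qed
  qed
qed

section \<open>Induced thetas assembled from two claws and three connections\<close>

section \<open>Thetas from three connections\<close>

text \<open>
  Induced paths from \<open>a\<close> to \<open>b\<close> with inner vertices in the connected sets \<open>Q i\<close> form an induced theta.
\<close>

definition theta_config :: "'a \<Rightarrow> 'a \<Rightarrow> 'i set \<Rightarrow> ('i \<Rightarrow> 'a set) \<Rightarrow> bool" where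
  "theta_config a b I Q \<longleftrightarrow> card I = 3 \<and> a \<noteq> b \<and> \<not> E a b \<and>
     (\<forall>i\<in>I. conn (Q i) \<and> a \<notin> Q i \<and> b \<notin> Q i \<and> touch {a} (Q i) \<and> touch {b} (Q i)) \<and>
     (\<forall>i\<in>I. \<forall>j\<in>I. i \<noteq> j \<longrightarrow> sep (Q i) (Q j))"

lemma sep_Un: "sep (A \<union> B) C \<longleftrightarrow> sep A C \<and> sep B C" "sep A (B \<union> C) \<longleftrightarrow> sep A B \<and> sep A C"
  unfolding sep_def touch_def by blast+

text \<open>A hypothesis cannot quantify over index types, so theta-freeness is assumed for the
  index set \<open>{..<3}\<close>; a configuration on any three indices is transported there by a
  bijection.\<close>

lemma theta_config_nat:
  assumes "theta_config a b I Q"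
  shows "\<exists>Q'. theta_config a b {..<3::nat} Q'"
proof -
  have "finite I" "card I = 3"
    using assms card.infinite unfolding theta_config_def by fastforce+
  then obtain h where h: "bij_betw h {..<3::nat} I"
    using ex_bij_betw_nat_finite[of I] by (auto simp: atLeast0LessThan)
  have "h i \<in> I" if "i < 3" for i using h that by (auto simp: bij_betw_def)
  moreover have "h i \<noteq> h j" if "i < 3" "j < 3" "i \<noteq> j" for i j
    using h that by (auto simp: bij_betw_def inj_on_def)
  ultimately have "theta_config a b {..<3::nat} (Q \<circ> h)"
    using assms unfolding theta_config_def by auto
  then show ?thesis by blast
qed

text \<open>An induced path between the vertices touching \<open>X\<close> and those touching
  \<open>Y\<close>, possibly a single vertex; distinctness turns the conditions on positions into
  conditions on vertices.\<close>

lemma shortest_connection: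
  assumes "conn Z" "touch Z X" "touch Z Y"
  obtains p where "ipath p" "set p \<subseteq> Z"
    "\<And>w. w \<in> set p \<Longrightarrow> touch {w} X \<longleftrightarrow> w = hd p"
    "\<And>w. w \<in> set p \<Longrightarrow> touch {w} Y \<longleftrightarrow> w = last p"
proof -
  have "\<exists>a\<in>Z. touch {a} X" "\<exists>b\<in>Z. touch {b} Y"
    using assms(2,3) unfolding touch_def by auto
  from induced_path_between[OF assms(1), of "\<lambda>w. touch {w} X" "\<lambda>w. touch {w} Y", OF this]
  obtain p where p: "ipath p" "set p \<subseteq> Z"
    "\<And>i. i < length p \<Longrightarrow> touch {p ! i} X \<longleftrightarrow> i = 0"
    "\<And>i. i < length p \<Longrightarrow> touch {p ! i} Y \<longleftrightarrow> i = length p - 1"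
    by blast
  have ne: "p \<noteq> []" "distinct p" using ipathD[OF p(1)] by auto
  have "touch {w} X \<longleftrightarrow> w = hd p" "touch {w} Y \<longleftrightarrow> w = last p" if w: "w \<in> set p" for w
  proof -
    obtain i where i: "i < length p" "w = p ! i" using w by (auto simp: in_set_conv_nth)
    have "p ! i = p ! 0 \<longleftrightarrow> i = 0" "p ! i = p ! (length p - 1) \<longleftrightarrow> i = length p - 1"
      using i(1) ne by (subst nth_eq_iff_index_eq; auto)+
    then show "touch {w} X \<longleftrightarrow> w = hd p" "touch {w} Y \<longleftrightarrow> w = last p"
      using p(3,4)[OF i(1)] i(2) ne by (simp_all add: hd_conv_nth last_conv_nth)
  qed
  then show ?thesis using that[OF p(1,2)] by blast
qed

text \<open>For the case that an end of a connection is itself a centre of the theta: the rest of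
  the path is still an induced path and is attached to the removed end.\<close>

lemma ipath_tl:
  assumes "ipath p" "hd p \<noteq> last p"
  shows "ipath (tl p)" "set (tl p) = set p - {hd p}" "touch {hd p} (set (tl p))"
proof -
  obtain x q where p: "p = x # q" using ipathD(1)[OF assms(1)] by (cases p) auto
  then have q: "q \<noteq> []" using assms(2) by auto
  show "ipath (tl p)" using ipath_drop[OF assms(1), of 1] p q by simp
  show "set (tl p) = set p - {hd p}" using ipathD(2)[OF assms(1)] p by auto
  have "E x (q ! 0)" using ipathD(3)[OF assms(1), of 0 1] p q by simp
  then show "touch {hd p} (set (tl p))" using p q by (auto simp: touch_def)
qed

lemma ipath_butlast:
  assumes "ipath p" "hd p \<noteq> last p"
  shows "ipath (butlast p)" "set (butlast p) = set p - {last p}" "touch {last p} (set (butlast p))"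
proof -
  have "hd (rev p) \<noteq> last (rev p)" using assms by (simp add: hd_rev last_rev)
  note tl = ipath_tl[OF ipath_rev[OF assms(1)] this]
  have *: "tl (rev p) = rev (butlast p)" by (metis butlast_rev rev_rev_ident)
  show "ipath (butlast p)" using ipath_rev[OF tl(1)] by (simp add: *)
  show "set (butlast p) = set p - {last p}" "touch {last p} (set (butlast p))"
    using tl(2,3) by (auto simp: * hd_rev)
qed

text \<open>Cut every \<open>Z i\<close> down to an induced path with ends \<open>s i\<close> and
  \<open>t i\<close>, and take claws towards the \<open>s i\<close> in \<open>X\<close> and towards
  the \<open>t i\<close> in \<open>Y\<close>. Their centres and the three joined legs form a theta,
  unless an end of a path that may serve as a centre equals or is adjacent to the other end; the
  conclusion describes this exception.\<close>

lemma short_connection: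
  assumes triangle_free: "\<And>x y z. E x y \<Longrightarrow> E y z \<Longrightarrow> \<not> E x z"
    and theta_free: "\<nexists>a b Q. theta_config a b {..<3::nat} Q"
    and X: "conn X" and Y: "conn Y" and XY: "sep X Y" and I: "card I = 3"
    and Z: "\<And>i. i \<in> I \<Longrightarrow> conn (Z i)" "\<And>i. i \<in> I \<Longrightarrow> Z i \<inter> X = {}" "\<And>i. i \<in> I \<Longrightarrow> Z i \<inter> Y = {}"
      "\<And>i. i \<in> I \<Longrightarrow> touch (Z i) X" "\<And>i. i \<in> I \<Longrightarrow> touch (Z i) Y"
    and sepZ: "\<And>i j. i \<in> I \<Longrightarrow> j \<in> I \<Longrightarrow> i \<noteq> j \<Longrightarrow> sep (Z i) (Z j)"
  shows "\<exists>i\<in>I. \<exists>s\<in>Z i. \<exists>t\<in>Z i. (s = t \<or> E s t) \<and> touch {s} X \<and> touch {t} Y \<and>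
           (two_nbrs s X \<or> two_nbrs t Y)"
proof (rule ccontr)
  assume no_short: "\<not> ?thesis"
  have "\<forall>i\<in>I. \<exists>p. ipath p \<and> set p \<subseteq> Z i \<and> (\<forall>w\<in>set p. touch {w} X \<longleftrightarrow> w = hd p) \<and>
      (\<forall>w\<in>set p. touch {w} Y \<longleftrightarrow> w = last p)"
  proof
    fix i assume i: "i \<in> I"
    show "\<exists>p. ipath p \<and> set p \<subseteq> Z i \<and> (\<forall>w\<in>set p. touch {w} X \<longleftrightarrow> w = hd p) \<and>
      (\<forall>w\<in>set p. touch {w} Y \<longleftrightarrow> w = last p)"
      using shortest_connection[OF Z(1)[OF i] Z(4)[OF i] Z(5)[OF i]] by metis
  qed
  from bchoice[OF this] obtain p where p: "\<And>i. i \<in> I \<Longrightarrow> ipath (p i)" "\<And>i. i \<in> I \<Longrightarrow> set (p i) \<subseteq> Z i"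
      "\<And>i w. i \<in> I \<Longrightarrow> w \<in> set (p i) \<Longrightarrow> touch {w} X \<longleftrightarrow> w = hd (p i)"
      "\<And>i w. i \<in> I \<Longrightarrow> w \<in> set (p i) \<Longrightarrow> touch {w} Y \<longleftrightarrow> w = last (p i)"
    by blast
  define P where "P i = set (p i)" for i
  define s where "s i = hd (p i)" for i
  define t where "t i = last (p i)" for i
  have P: "conn (P i)" "P i \<subseteq> Z i" "s i \<in> P i" "t i \<in> P i" if "i \<in> I" for i
    using p(1,2)[OF that] ipath_conn ipathD(1) by (auto simp: P_def s_def t_def)
  have PX: "touch {w} X \<longleftrightarrow> w = s i" and PY: "touch {w} Y \<longleftrightarrow> w = t i"
    if "i \<in> I" "w \<in> P i" for i w
    using p(3,4)[of i w] that by (auto simp: P_def s_def t_def)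
  have outX: "w \<notin> X" and outY: "w \<notin> Y" if "i \<in> I" "w \<in> P i" for i w
    using that P(2) Z(2,3) by blast+
  have sepP: "sep (P i) (P j)" if "i \<in> I" "j \<in> I" "i \<noteq> j" for i j
    using sep_mono[OF sepZ[OF that]] P(2) that by blast
  have indep: "\<not> E x y" if "i \<in> I" "j \<in> I" "i \<noteq> j" "x \<in> P i" "y \<in> P j" for i j x y
    using sepP[OF that(1-3)] that(4,5) unfolding sep_def touch_def by blast
  have diff: "x \<noteq> y" if "i \<in> I" "j \<in> I" "i \<noteq> j" "x \<in> P i" "y \<in> P j" for i j x y
    using sepP[OF that(1-3)] that(4,5) unfolding sep_def by blast
  \<comment> \<open>The negated conclusion enters here: an end that can serve as a centre is neither
    equal nor adjacent to the opposite end of its path.\<close>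
  have far: "s i \<noteq> t i \<and> \<not> E (s i) (t i)" if "i \<in> I" "two_nbrs (s i) X \<or> two_nbrs (t i) Y" for i
  proof -
    have "touch {s i} X" "touch {t i} Y" using PX PY P(3,4) that(1) by auto
    then show ?thesis using no_short that P(2-4)[OF that(1)] by blast
  qed
  have "inj_on s I" "inj_on t I"
    unfolding inj_on_def using diff P(3,4) by metis+
  moreover have "\<not> E (s i) (s j)" "\<not> E (t i) (t j)" if "i \<in> I" "j \<in> I" for i j
    using indep[OF that] P(3,4) that E_irrefl by metis+
  ultimately have "\<exists>c F. tripod X I s c F" "\<exists>c F. tripod Y I t c F"
    using outX outY P(3,4) PX PY
    by (intro exists_tripod[OF triangle_free]; use X Y I in blast)+
  then obtain c F c' F' where tX: "tripod X I s c F" and tY: "tripod Y I t c' F'"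
    by blast
  have c: "c \<in> X \<or> (\<exists>k\<in>I. c = s k \<and> two_nbrs (s k) X)"
    and F: "\<And>i. i \<in> I \<Longrightarrow> F i \<subseteq> insert (s i) X - {c}"
      "\<And>i. i \<in> I \<Longrightarrow> s i \<in> F i \<and> conn (F i) \<and> touch {c} (F i) \<or> F i = {} \<and> s i = c"
    and sepF: "\<And>i j. i \<in> I \<Longrightarrow> j \<in> I \<Longrightarrow> i \<noteq> j \<Longrightarrow> sep (F i) (F j)"
    using tX unfolding tripod_def by blast+
  have c': "c' \<in> Y \<or> (\<exists>k\<in>I. c' = t k \<and> two_nbrs (t k) Y)"
    and F': "\<And>i. i \<in> I \<Longrightarrow> F' i \<subseteq> insert (t i) Y - {c'}"
      "\<And>i. i \<in> I \<Longrightarrow> t i \<in> F' i \<and> conn (F' i) \<and> touch {c'} (F' i) \<or> F' i = {} \<and> t i = c'"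
    and sepF': "\<And>i j. i \<in> I \<Longrightarrow> j \<in> I \<Longrightarrow> i \<noteq> j \<Longrightarrow> sep (F' i) (F' j)"
    using tY unfolding tripod_def by blast+
  \<comment> \<open>A centre on a path lies outside \<open>X\<close>, so it is some
    \<open>s k\<close> with two neighbours in \<open>X\<close>; disjointness of the paths gives
    \<open>k = i\<close>, and \<open>far\<close> applies.\<close>
  have cP: "c = s i" "s i \<noteq> t i" "\<not> E (s i) (t i)" if "i \<in> I" "c \<in> P i" for i
  proof -
    have "c \<notin> X" using outX that by blast
    then obtain k where k: "k \<in> I" "c = s k" "two_nbrs (s k) X" using c by blast
    then have "k = i" using diff[OF k(1) that(1) _ P(3)[OF k(1)] that(2)] by blast
    then show "c = s i" "s i \<noteq> t i" "\<not> E (s i) (t i)" using k far[OF that(1)] by auto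
  qed
  have c'P: "c' = t i" "s i \<noteq> t i" "\<not> E (s i) (t i)" if "i \<in> I" "c' \<in> P i" for i
  proof -
    have "c' \<notin> Y" using outY that by blast
    then obtain k where k: "k \<in> I" "c' = t k" "two_nbrs (t k) Y" using c' by blast
    then have "k = i" using diff[OF k(1) that(1) _ P(4)[OF k(1)] that(2)] by blast
    then show "c' = t i" "s i \<noteq> t i" "\<not> E (s i) (t i)" using k far[OF that(1)] by auto
  qed
  have XY': "x \<noteq> y" "\<not> E x y" if "x \<in> X" "y \<in> Y" for x y
    using XY that unfolding sep_def touch_def by auto
  \<comment> \<open>Within a path only \<open>s k\<close> touches \<open>X\<close> and only
    \<open>t k\<close> touches \<open>Y\<close>; with \<open>far\<close> this handles a centre that
    is a path end. Centres on different paths are kept apart by \<open>diff\<close> and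
    \<open>indep\<close>.\<close>
  have cc': "c \<noteq> c' \<and> \<not> E c c'"
  proof (cases "c \<in> X")
    case True
    show ?thesis
    proof (cases "c' \<in> Y")
      case False
      then obtain k where k: "k \<in> I" "c' = t k" "two_nbrs (t k) Y" using c' by blast
      have "\<not> touch {t k} X" using PX[OF k(1) P(4)[OF k(1)]] far[OF k(1)] k(3) by metis
      then show ?thesis using True k outX[OF k(1) P(4)[OF k(1)]] E_sym unfolding touch_def by auto
    qed (use True XY' in auto)
  next
    case False
    then obtain k where k: "k \<in> I" "c = s k" "two_nbrs (s k) X" using c by blast
    show ?thesis
    proof (cases "c' \<in> Y")
      case True
      have "\<not> touch {s k} Y" using PY[OF k(1) P(3)[OF k(1)]] far[OF k(1)] k(3) by metis
      then show ?thesis using True k outY[OF k(1) P(3)[OF k(1)]] unfolding touch_def by auto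
    next
      case False
      then obtain l where l: "l \<in> I" "c' = t l" using c' by blast
      then show ?thesis using k far[of k] diff indep P(3,4) by (cases "k = l") auto
    qed
  qed
  \<comment> \<open>The centres are removed from the paths, as they may be path ends;
    \<open>Q i\<close> then supplies the interior of the \<open>i\<close>-th path of the
    theta.\<close>
  define W where "W i = P i - {c, c'}" for i
  define Q where "Q i = F i \<union> W i \<union> F' i" for i
  have cF: "c \<notin> F i" and c'F: "c' \<notin> F' i" and cF': "c \<notin> F' i" and c'F': "c' \<notin> F i" if "i \<in> I" for i
  proof -
    show "c \<notin> F i" "c' \<notin> F' i" using F(1) F'(1) that by blast+
    show "c \<notin> F' i"
    proof
      assume "c \<in> F' i"
      then have "c = t i \<or> c \<in> Y" using F'(1)[OF that] by blast
      moreover have "c \<notin> Y" using c XY' outY P(3) by blast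
      ultimately have "c = t i" by blast
      then show False using cP[OF that] P(4)[OF that] by auto
    qed
    show "c' \<notin> F i"
    proof
      assume "c' \<in> F i"
      then have "c' = s i \<or> c' \<in> X" using F(1)[OF that] by blast
      moreover have "c' \<notin> X" using c' XY' outX P(4) by blast
      ultimately have "c' = s i" by blast
      then show False using c'P[OF that] P(3)[OF that] by auto
    qed
  qed
  \<comment> \<open>Four cases, according to which ends of the path are centres. Such an end has an
    empty leg and is dropped from the path; any other end lies in its leg and glues the leg to the
    path.\<close>
  have Q: "conn (Q i) \<and> touch {c} (Q i) \<and> touch {c'} (Q i)" if i: "i \<in> I" for i
  proof (cases "s i = c")
    case sc: True
    then have fr: "s i \<noteq> t i" "\<not> E (s i) (t i)" using cP(2,3)[OF i] P(3)[OF i] by auto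
    have Fi: "F i = {}" using F(2)[OF i] cF[OF i] sc by auto
    have ip: "ipath (p i)" "hd (p i) \<noteq> last (p i)" using p(1)[OF i] fr by (auto simp: s_def t_def)
    note tl = ipath_tl[OF ip]
    have tl': "set (tl (p i)) = P i - {c}" using tl(2) sc by (simp add: P_def s_def)
    show ?thesis
    proof (cases "t i = c'")
      case tc: True
      then have F'i: "F' i = {}" using F'(2)[OF i] c'F[OF i] by auto
      have lst: "last (tl (p i)) = c'" using tc ip tl(2)
        by (metis last_tl ipathD(1) tl(1) t_def)
      \<comment> \<open>Both ends are centres, so an inner vertex is required: without one the ends
        would be adjacent, against \<open>fr\<close>.\<close>
      have "hd (tl (p i)) \<noteq> last (tl (p i))"
      proof
        assume "hd (tl (p i)) = last (tl (p i))"
        moreover have "E (s i) (hd (tl (p i)))"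
          using ipathD(3)[OF ip(1), of 0 1] ip ipathD(1)[OF tl(1)] ipathD(1)[OF ip(1)]
          by (cases "p i"; cases "tl (p i)") (auto simp: s_def)
        ultimately show False using fr tc lst by simp
      qed
      note bl = ipath_butlast[OF tl(1) this]
      have W: "set (butlast (tl (p i))) = W i" using bl(2) tl' lst by (auto simp: W_def)
      \<comment> \<open>The neighbour of \<open>c\<close> on the path survives the removal of
        \<open>c'\<close>, because the two ends are not adjacent.\<close>
      have "touch {c} (W i)"
        using tl(3) fr(2) sc tc tl' unfolding W_def touch_def s_def[symmetric]
        by (metis Diff_iff Diff_insert2 empty_iff insert_iff singletonD tl')
      moreover have "touch {c'} (W i)" using bl(3) W lst by simp
      ultimately show ?thesis using ipath_conn[OF bl(1)] W Fi F'i by (simp add: Q_def)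
    next
      case tc: False
      then have F'i: "t i \<in> F' i" "conn (F' i)" "touch {c'} (F' i)" using F'(2)[OF i] by auto
      have "c' \<notin> P i" using c'P(1)[OF i] tc by auto
      then have W: "W i = set (tl (p i))" using tl' by (auto simp: W_def)
      have "t i \<in> W i" unfolding W tl' using P(4)[OF i] fr(1) sc by simp
      moreover have "conn (W i)" unfolding W by (rule ipath_conn[OF tl(1)])
      ultimately have "conn (W i \<union> F' i)" using conn_Un F'i(1,2) by blast
      moreover have "touch {c} (W i)" using tl(3) W sc by (simp add: s_def)
      ultimately show ?thesis using F'i(3) Fi touch_mono unfolding Q_def
        by (metis Un_empty_left Un_upper1 Un_upper2 subset_refl)
    qed
  next
    case sc: False
    then have Fi: "s i \<in> F i" "conn (F i)" "touch {c} (F i)" using F(2)[OF i] by auto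
    have cPi: "c \<notin> P i" using cP(1)[OF i] sc by auto
    show ?thesis
    proof (cases "t i = c'")
      case tc: True
      then have fr: "s i \<noteq> t i" "\<not> E (s i) (t i)" using c'P(2,3)[OF i] P(4)[OF i] by auto
      have ip: "ipath (p i)" "hd (p i) \<noteq> last (p i)" using p(1)[OF i] fr by (auto simp: s_def t_def)
      note bl = ipath_butlast[OF ip]
      have F'i: "F' i = {}" using F'(2)[OF i] c'F[OF i] tc by auto
      have W: "set (butlast (p i)) = W i" using bl(2) tc cPi by (auto simp: W_def P_def t_def)
      have "s i \<in> W i" unfolding W_def using P(3)[OF i] fr(1) sc tc by simp
      moreover have "conn (W i)" unfolding W[symmetric] by (rule ipath_conn[OF bl(1)])
      ultimately have "conn (F i \<union> W i)" using conn_Un Fi(1,2) by blast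
      moreover have "touch {c'} (W i)" using bl(3) W tc by (simp add: t_def)
      ultimately show ?thesis using Fi(3) F'i touch_mono unfolding Q_def
        by (metis Un_empty_right Un_upper1 Un_upper2 subset_refl)
    next
      case tc: False
      then have F'i: "t i \<in> F' i" "conn (F' i)" "touch {c'} (F' i)" using F'(2)[OF i] by auto
      have "c' \<notin> P i" using c'P(1)[OF i] tc by auto
      then have W: "W i = P i" using cPi by (auto simp: W_def)
      have "conn (F i \<union> W i)" using conn_Un[OF Fi(2) P(1)[OF i]] Fi(1) P(3)[OF i] W by auto
      then have "conn (F i \<union> W i \<union> F' i)"
        using conn_Un[OF _ F'i(2)] F'i(1) P(4)[OF i] W by blast
      then show ?thesis using F'i(3) Fi(3) touch_mono unfolding Q_def
        by (metis Un_upper1 Un_upper2 subset_refl sup_assoc)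
    qed
  qed
  have sepFW: "sep (F i) (W j)" if "i \<in> I" "j \<in> I" "i \<noteq> j" for i j
  proof -
    \<comment> \<open>A vertex of \<open>X\<close> can be adjacent to another path only at its end
      \<open>s j\<close>, which belongs to \<open>F j\<close> unless it is the centre; then
      \<open>sepF\<close> applies.\<close>
    have "x \<noteq> w \<and> \<not> E x w" if x: "x \<in> F i" and w: "w \<in> W j" for x w
    proof (cases "x \<in> X")
      case True
      have wP: "w \<in> P j" "w \<noteq> c" using w by (auto simp: W_def)
      show ?thesis
      proof (cases "w = s j")
        case True
        then have "w \<in> F j" using F(2)[OF \<open>j \<in> I\<close>] wP(2) by auto
        then show ?thesis using sepF[OF \<open>i \<in> I\<close> \<open>j \<in> I\<close> \<open>i \<noteq> j\<close>] x unfolding sep_def touch_def by blast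
      next
        case False
        then have "\<not> touch {w} X" using PX[OF \<open>j \<in> I\<close> wP(1)] by simp
        then show ?thesis using True outX[OF \<open>j \<in> I\<close> wP(1)] E_sym unfolding touch_def by blast
      qed
    next
      case False
      then have "x = s i" using F(1)[OF \<open>i \<in> I\<close>] x by blast
      then show ?thesis using w P(3) diff[of i j] indep[of i j] that \<open>i \<in> I\<close> \<open>j \<in> I\<close> \<open>i \<noteq> j\<close>
        by (auto simp: W_def)
    qed
    then show ?thesis unfolding sep_def touch_def by blast
  qed
  have sepF'W: "sep (F' i) (W j)" if "i \<in> I" "j \<in> I" "i \<noteq> j" for i j
  proof -
    have "x \<noteq> w \<and> \<not> E x w" if x: "x \<in> F' i" and w: "w \<in> W j" for x w
    proof (cases "x \<in> Y")
      case True
      have wP: "w \<in> P j" "w \<noteq> c'" using w by (auto simp: W_def)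
      show ?thesis
      proof (cases "w = t j")
        case True
        then have "w \<in> F' j" using F'(2)[OF \<open>j \<in> I\<close>] wP(2) by auto
        then show ?thesis using sepF'[OF \<open>i \<in> I\<close> \<open>j \<in> I\<close> \<open>i \<noteq> j\<close>] x unfolding sep_def touch_def by blast
      next
        case False
        then have "\<not> touch {w} Y" using PY[OF \<open>j \<in> I\<close> wP(1)] by simp
        then show ?thesis using True outY[OF \<open>j \<in> I\<close> wP(1)] E_sym unfolding touch_def by blast
      qed
    next
      case False
      then have "x = t i" using F'(1)[OF \<open>i \<in> I\<close>] x by blast
      then show ?thesis using w P(4) diff[of i j] indep[of i j] that \<open>i \<in> I\<close> \<open>j \<in> I\<close> \<open>i \<noteq> j\<close>
        by (auto simp: W_def)
    qed
    then show ?thesis unfolding sep_def touch_def by blast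
  qed
  have sepFF': "sep (F i) (F' j)" if "i \<in> I" "j \<in> I" "i \<noteq> j" for i j
  proof -
    \<comment> \<open>A leg vertex outside \<open>Y\<close> is \<open>t j\<close> and belongs to
      \<open>W j\<close>; one outside \<open>X\<close> is \<open>s i\<close> and belongs to
      \<open>W i\<close>. This reduces the claim to the two previous separations and to that of
      \<open>X\<close> and \<open>Y\<close>.\<close>
    have "x \<noteq> w \<and> \<not> E x w" if x: "x \<in> F i" and w: "w \<in> F' j" for x w
    proof (cases "w \<in> Y")
      case False
      then have "w = t j" "w \<noteq> c'" "w \<noteq> c" using F'(1)[OF \<open>j \<in> I\<close>] cF'[OF \<open>j \<in> I\<close>] w by auto
      then have "w \<in> W j" using P(4)[OF \<open>j \<in> I\<close>] by (simp add: W_def)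
      then show ?thesis using sepFW[OF \<open>i \<in> I\<close> \<open>j \<in> I\<close> \<open>i \<noteq> j\<close>] x unfolding sep_def touch_def by blast
    next
      case wY: True
      show ?thesis
      proof (cases "x \<in> X")
        case True
        then show ?thesis using XY' wY by blast
      next
        case False
        then have "x = s i" "x \<noteq> c" "x \<noteq> c'" using F(1)[OF \<open>i \<in> I\<close>] c'F'[OF \<open>i \<in> I\<close>] x by auto
        then have "x \<in> W i" using P(3)[OF \<open>i \<in> I\<close>] by (simp add: W_def)
        then show ?thesis using sepF'W[OF \<open>j \<in> I\<close> \<open>i \<in> I\<close>] \<open>i \<noteq> j\<close> w E_sym
          unfolding sep_def touch_def by blast
      qed
    qed
    then show ?thesis unfolding sep_def touch_def by blast
  qed
  have sepQ: "sep (Q i) (Q j)" if "i \<in> I" "j \<in> I" "i \<noteq> j" for i j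
  proof -
    have "sep (W i) (W j)" using sep_mono[OF sepP[OF that]] by (auto simp: W_def)
    moreover have "j \<noteq> i" using that(3) by simp
    note sepF[OF that] sepF'[OF that] sepFW[OF that] sepF'W[OF that] sepFF'[OF that]
      sep_sym[OF sepFW[OF that(2,1) this]] sep_sym[OF sepF'W[OF that(2,1) this]]
      sep_sym[OF sepFF'[OF that(2,1) this]]
    ultimately show ?thesis by (simp add: Q_def sep_Un)
  qed
  have "c \<notin> Q i" "c' \<notin> Q i" if "i \<in> I" for i
    using cF cF' c'F c'F' that by (auto simp: Q_def W_def)
  then have "theta_config c c' I Q"
    unfolding theta_config_def using I cc' Q sepQ by blast
  then show False using theta_config_nat theta_free by blast
qed

section \<open>Linked pairs, close triples and the pigeonhole argument\<close>

section \<open>Models of bicliques\<close>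

text \<open>Without such a \<open>D\<close>, the links of different pairs are separated, since two
  that meet or touch would form a set of at most four vertices reaching three of the
  \<open>B j\<close>. Joining \<open>B 0\<close> to \<open>B 1\<close> through \<open>B 2\<close>,
  \<open>B 3\<close> and \<open>B 4\<close> then contradicts
  \<open>short_connection\<close>.\<close>

lemma short_link_or_close_triple:
  fixes B :: "nat \<Rightarrow> 'a set"
  assumes triangle_free: "\<And>x y z. E x y \<Longrightarrow> E y z \<Longrightarrow> \<not> E x z"
    and theta_free: "\<nexists>a b Q. theta_config a b {..<3::nat} Q"
    and B: "\<And>j. j < 5 \<Longrightarrow> conn (B j)" "\<And>j. j < 5 \<Longrightarrow> A \<inter> B j = {}"
      "\<And>j k. j < 5 \<Longrightarrow> k < 5 \<Longrightarrow> j \<noteq> k \<Longrightarrow> sep (B j) (B k)"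
    and linked: "\<And>j k. j < 5 \<Longrightarrow> k < 5 \<Longrightarrow> j \<noteq> k \<Longrightarrow>
      \<exists>q \<subseteq> A. conn q \<and> card q \<le> 2 \<and> touch q (B j) \<and> touch q (B k)"
  shows "\<exists>D \<subseteq> A. conn D \<and> card D \<le> 4 \<and> (\<exists>C \<subseteq> {..<5}. card C = 3 \<and> (\<forall>j\<in>C. touch D (B j)))"
proof (rule ccontr)
  assume "\<not> ?thesis"
  then have no3: "\<not> (touch D (B j) \<and> touch D (B k) \<and> touch D (B m))"
    if "D \<subseteq> A" "conn D" "card D \<le> 4" "j < 5" "k < 5" "m < 5" "j \<noteq> k" "j \<noteq> m" "k \<noteq> m" for D j k m
    using that by (auto dest!: spec[of _ D] spec[of _ "{j, k, m}"])
  have "\<forall>e l. \<exists>q. e < 5 \<longrightarrow> l < 5 \<longrightarrow> e \<noteq> l \<longrightarrow>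
      q \<subseteq> A \<and> conn q \<and> card q \<le> 2 \<and> touch q (B e) \<and> touch q (B l)"
    using linked by blast
  then obtain q where q: "\<And>e l. e < 5 \<Longrightarrow> l < 5 \<Longrightarrow> e \<noteq> l \<Longrightarrow>
      q e l \<subseteq> A \<and> conn (q e l) \<and> card (q e l) \<le> 2 \<and> touch (q e l) (B e) \<and> touch (q e l) (B l)"
    by metis
  have q_only: "\<not> touch (q e l) (B m)" if "e < 5" "l < 5" "e \<noteq> l" "m < 5" "m \<noteq> e" "m \<noteq> l" for e l m
    using no3[of "q e l" e l m] q[OF that(1-3)] that by auto
  \<comment> \<open>The condition on the pairs provides a third index besides \<open>e\<close> and
    \<open>l\<close>; the union of two links has at most \<open>2 + 2\<close> vertices.\<close>
  have sep_q: "sep (q e l) (q f m)"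
    if "e < 5" "l < 5" "e \<noteq> l" "f < 5" "m < 5" "f \<noteq> m" "\<not> {f, m} \<subseteq> {e, l}" for e l f m
  proof (rule ccontr)
    assume "\<not> sep (q e l) (q f m)"
    then have "conn (q e l \<union> q f m)"
      using q[OF that(1-3)] q[OF that(4-6)] by (intro conn_Un) (auto simp: sep_def)
    moreover have "card (q e l \<union> q f m) \<le> 4"
      using card_Un_le[of "q e l" "q f m"] q[OF that(1-3)] q[OF that(4-6)] by linarith
    moreover have "\<exists>n\<in>{f, m}. n \<noteq> e \<and> n \<noteq> l" using that(7) by blast
    then obtain n where "n \<in> {f, m}" "n \<noteq> e" "n \<noteq> l" by blast
    moreover have "touch (q e l \<union> q f m) (B j)" if "j \<in> {e, l, f, m}" for j
      using that q[OF \<open>e < 5\<close> \<open>l < 5\<close> \<open>e \<noteq> l\<close>] q[OF \<open>f < 5\<close> \<open>m < 5\<close> \<open>f \<noteq> m\<close>]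
      unfolding touch_def by blast
    ultimately show False
      using no3[of "q e l \<union> q f m" e l n] q[OF that(1-3)] q[OF that(4-6)] that by auto
  qed
  \<comment> \<open>\<open>Z l\<close> runs from \<open>B 0\<close> over a link to
    \<open>B l\<close> and over a second link to \<open>B 1\<close>.\<close>
  define Z where "Z l = q 0 l \<union> B l \<union> q 1 l" for l
  have ql: "q e l \<subseteq> A" "conn (q e l)" "touch (q e l) (B e)" "touch (q e l) (B l)"
    if "e < 2" "l \<in> {2, 3, 4}" for e l
    using q[of e l] that by auto
  have "\<exists>l\<in>{2,3,4}. \<exists>s\<in>Z l. \<exists>t\<in>Z l. (s = t \<or> E s t) \<and> touch {s} (B 0) \<and> touch {t} (B 1) \<and>
      (two_nbrs s (B 0) \<or> two_nbrs t (B 1))"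
  proof (rule short_connection[OF triangle_free theta_free])
    fix l :: nat assume l: "l \<in> {2, 3, 4}"
    note q0 = ql[of 0 l, OF _ l] and q1 = ql[of 1 l, OF _ l]
    have "conn (B l)" using B(1)[of l] l by auto
    then have "conn (q 0 l \<union> B l)" using conn_Un q0 by auto
    moreover have "touch (B l) (q 1 l)" by (rule touch_sym) (use q1 in simp)
    then have "touch (q 0 l \<union> B l) (q 1 l)" by (rule touch_mono) auto
    moreover have "conn (q 1 l)" using q1(2) by simp
    ultimately show "conn (Z l)" unfolding Z_def using conn_Un[of "q 0 l \<union> B l" "q 1 l"] by simp
    have "B l \<inter> B 0 = {}" "B l \<inter> B 1 = {}" using B(3)[of l 0] B(3)[of l 1] l by (auto simp: sep_def)
    then show "Z l \<inter> B 0 = {}" "Z l \<inter> B 1 = {}"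
      using q0 q1 B(2)[of 0] B(2)[of 1] unfolding Z_def by auto
    show "touch (Z l) (B 0)" using q0(3) unfolding Z_def by (auto simp: touch_def)
    show "touch (Z l) (B 1)" using q1(3) unfolding Z_def by (auto simp: touch_def)
    fix m :: nat assume m: "m \<in> {2, 3, 4}" and lm: "l \<noteq> m"
    have *: "sep (q e l) (q f m)" if "e < 2" "f < 2" for e f
      using sep_q[of e l f m] that l m lm by auto
    have **: "sep (q e i) (B j)" if "e < 2" "i \<in> {2,3,4}" "j \<in> {2,3,4}" "i \<noteq> j" for e i j
    proof -
      have "j < 5" "i < 5" "j \<noteq> e" "i \<noteq> e" "e < 5" using that by auto
      then show ?thesis
        using q_only[of e i j] ql(1)[OF that(1,2)] B(2)[of j] that(4) unfolding sep_def by blast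
    qed
    show "sep (Z l) (Z m)"
      unfolding Z_def sep_Un
      using * **[OF _ l m lm] sep_sym[OF **[OF _ m l lm[symmetric]]] B(3)[of l m] lm l m by auto
  qed (use B in auto)
  then obtain l s t where l: "l \<in> {2,3,4}" and st: "s \<in> Z l" "t \<in> Z l" "s = t \<or> E s t"
    "touch {s} (B 0)" "touch {t} (B 1)"
    by blast
  \<comment> \<open>Only the piece \<open>q 0 l\<close> of \<open>Z l\<close> touches
    \<open>B 0\<close> and only \<open>q 1 l\<close> touches \<open>B 1\<close>, so \<open>s\<close>
    and \<open>t\<close> fall into separated pieces and can be neither equal nor adjacent.\<close>
  have "\<not> touch (B l) (B 0)" "\<not> touch (q 1 l) (B 0)" "\<not> touch (B l) (B 1)" "\<not> touch (q 0 l) (B 1)"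
    using l B(3)[of l 0] B(3)[of l 1] q_only[of 1 l 0] q_only[of 0 l 1] by (auto simp: sep_def)
  then have "s \<in> q 0 l" "t \<in> q 1 l"
    using st(1,2,4,5) unfolding Z_def touch_def by blast+
  moreover have "sep (q 0 l) (q 1 l)" using sep_q[of 0 l 1 l] l by auto
  ultimately show False using st(3) unfolding sep_def touch_def by blast
qed

lemma pigeonhole_triple:
  assumes "finite S" "2 * card (f ` S) < card S"
  obtains I where "I \<subseteq> S" "card I = 3" "\<And>i j. i \<in> I \<Longrightarrow> j \<in> I \<Longrightarrow> f i = f j"
proof -
  have "\<exists>c\<in>f ` S. 2 < card {i \<in> S. f i = c}"
  proof (rule ccontr)
    assume "\<not> ?thesis"
    then have "(\<Sum>c\<in>f ` S. card {i \<in> S. f i = c}) \<le> (\<Sum>c\<in>f ` S. 2)"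
      by (intro sum_mono) auto
    moreover have "card (\<Union>c\<in>f ` S. {i \<in> S. f i = c}) \<le> (\<Sum>c\<in>f ` S. card {i \<in> S. f i = c})"
      by (intro card_UN_le) (use assms in auto)
    moreover have "(\<Union>c\<in>f ` S. {i \<in> S. f i = c}) = S" by auto
    ultimately show False using assms(2) by simp
  qed
  then obtain c where "3 \<le> card {i \<in> S. f i = c}" by (auto simp: numeral_3_eq_3 Suc_le_eq numeral_2_eq_2)
  then obtain I where "I \<subseteq> {i \<in> S. f i = c}" "card I = 3"
    by (rule obtain_subset_with_card_n)
  then show ?thesis using that[of I] by blast
qed

text \<open>The bound \<open>64\<close> is twice the number \<open>2^5\<close> of colours of the
  sets \<open>A i\<close>, so three of them share a colour. If it is an unlinked pair, these three
  sets are the connections between two of the \<open>B j\<close>; if it is a close triple, three of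
  the \<open>B j\<close> are the connections between small parts of two of the sets.\<close>

lemma biclique_model_contradiction:
  fixes A :: "'i \<Rightarrow> 'a set" and B :: "nat \<Rightarrow> 'a set"
  assumes girth: "\<And>D s. conn D \<Longrightarrow> card D \<le> 4 \<Longrightarrow> s \<notin> D \<Longrightarrow> \<not> two_nbrs s D"
    and theta_free: "\<nexists>a b Q. theta_config a b {..<3::nat} Q"
    and S: "finite S" "64 < card S"
    and A: "\<And>i. i \<in> S \<Longrightarrow> conn (A i)" "\<And>i i'. i \<in> S \<Longrightarrow> i' \<in> S \<Longrightarrow> i \<noteq> i' \<Longrightarrow> sep (A i) (A i')"
    and B: "\<And>j. j < 5 \<Longrightarrow> conn (B j)" "\<And>j k. j < 5 \<Longrightarrow> k < 5 \<Longrightarrow> j \<noteq> k \<Longrightarrow> sep (B j) (B k)"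
    and AB: "\<And>i j. i \<in> S \<Longrightarrow> j < 5 \<Longrightarrow> A i \<inter> B j = {}" "\<And>i j. i \<in> S \<Longrightarrow> j < 5 \<Longrightarrow> touch (A i) (B j)"
  shows False
proof -
  \<comment> \<open>A triangle makes \<open>x\<close> a vertex with two neighbours in the connected
    set \<open>{y, z}\<close>.\<close>
  have triangle_free: "\<not> E x z" if "E x y" "E y z" for x y z
  proof
    assume "E x z"
    moreover have "card {y, z} \<le> 4" by (simp add: card_insert_if)
    ultimately show False
      using girth[OF conn_edge[OF that(2)], of x] that E_irrefl unfolding two_nbrs_def by auto
  qed
  \<comment> \<open>Every \<open>A i\<close> gets one of the 32 subsets of \<open>{..<5}\<close> as a colour: a pair that it does not link or
    a triple that it touches closely.\<close>
  define unlinked where "unlinked i C \<longleftrightarrow> (\<exists>j k. C = {j, k} \<and> j \<noteq> k \<and>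
      \<not> (\<exists>q \<subseteq> A i. conn q \<and> card q \<le> 2 \<and> touch q (B j) \<and> touch q (B k)))" for i C
  define close where "close i C \<longleftrightarrow> card C = 3 \<and>
      (\<exists>D \<subseteq> A i. conn D \<and> card D \<le> 4 \<and> (\<forall>j\<in>C. touch D (B j)))" for i C
  have "\<exists>C \<subseteq> {..<5}. unlinked i C \<or> close i C" if i: "i \<in> S" for i
  proof (cases "\<exists>C \<subseteq> {..<5}. unlinked i C")
    case False
    have link: "\<exists>q \<subseteq> A i. conn q \<and> card q \<le> 2 \<and> touch q (B j) \<and> touch q (B k)"
      if "j < 5" "k < 5" "j \<noteq> k" for j k
    proof -
      have "{j, k} \<subseteq> {..<5}" using that by simp
      then have "\<not> unlinked i {j, k}" using False by blast
      then show ?thesis using that(3) unfolding unlinked_def by blast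
    qed
    have "\<exists>D \<subseteq> A i. conn D \<and> card D \<le> 4 \<and> (\<exists>C \<subseteq> {..<5}. card C = 3 \<and> (\<forall>j\<in>C. touch D (B j)))"
      by (rule short_link_or_close_triple[OF triangle_free theta_free])
        (use B AB(1)[OF i] link in auto)
    then obtain D C where "D \<subseteq> A i" "conn D" "card D \<le> 4" "C \<subseteq> {..<5}" "card C = 3"
      "\<forall>j\<in>C. touch D (B j)"
      by blast
    then have "C \<subseteq> {..<5} \<and> close i C" unfolding close_def by blast
    then show ?thesis by blast
  qed blast
  then have "\<forall>i\<in>S. \<exists>C. C \<subseteq> {..<5} \<and> (unlinked i C \<or> close i C)" by blast
  from bchoice[OF this] obtain f
    where f: "\<And>i. i \<in> S \<Longrightarrow> f i \<subseteq> {..<5} \<and> (unlinked i (f i) \<or> close i (f i))" by blast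
  have "f ` S \<subseteq> Pow {..<5}" using f by blast
  then have "card (f ` S) \<le> card (Pow {..<5::nat})" by (intro card_mono) simp_all
  then have "2 * card (f ` S) < card S" using S(2) by (simp add: card_Pow)
  then obtain I where I: "I \<subseteq> S" "card I = 3" "\<And>i j. i \<in> I \<Longrightarrow> j \<in> I \<Longrightarrow> f i = f j"
    using pigeonhole_triple[OF S(1)] by blast
  obtain i i' where ii': "i \<in> I" "i' \<in> I" "i \<noteq> i'"
    using I(2) unfolding card_3_iff by blast
  define C where "C = f i"
  have C: "C \<subseteq> {..<5}" "unlinked l C \<or> close l C" if "l \<in> I" for l
    using f[of l] I(1) I(3)[OF ii'(1) that] that unfolding C_def by auto
  consider "\<exists>l\<in>I. close l C" | "\<forall>l\<in>I. \<not> close l C" by blast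
  then show False
  proof cases
    case 1
    then have C3: "card C = 3" by (auto simp: close_def)
    \<comment> \<open>A colour of size three is never a pair, so one close set forces all three to
      be close.\<close>
    have "\<not> unlinked l C" for l using C3 unfolding unlinked_def by (auto simp: card_insert_if)
    then have "close i C" "close i' C" using C(2) ii' by blast+
    then obtain D D' where D: "D \<subseteq> A i" "conn D" "card D \<le> 4" "\<forall>j\<in>C. touch D (B j)"
      and D': "D' \<subseteq> A i'" "conn D'" "card D' \<le> 4" "\<forall>j\<in>C. touch D' (B j)"
      unfolding close_def by blast
    have C5: "j < 5" if "j \<in> C" for j using C(1)[OF ii'(1)] that by auto
    have iS: "i \<in> S" "i' \<in> S" using ii' I(1) by auto
    have dis: "B j \<inter> D = {}" "B j \<inter> D' = {}" if "j \<in> C" for j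
      using AB(1)[OF iS(1) C5[OF that]] AB(1)[OF iS(2) C5[OF that]] D(1) D'(1) by blast+
    \<comment> \<open>The roles of the sides are exchanged: \<open>D\<close> and \<open>D'\<close>
      are to be joined, and the \<open>B j\<close> with \<open>j\<close> in \<open>C\<close> are the
      connections.\<close>
    have "\<exists>j\<in>C. \<exists>s\<in>B j. \<exists>t\<in>B j. (s = t \<or> E s t) \<and> touch {s} D \<and> touch {t} D' \<and>
        (two_nbrs s D \<or> two_nbrs t D')"
    proof (rule short_connection[OF triangle_free theta_free D(2) D'(2) _ C3])
      show "sep D D'" using sep_mono[OF A(2)[OF iS ii'(3)]] D(1) D'(1) by blast
    qed (use B C5 dis D(4) D'(4) touch_sym in auto)
    \<comment> \<open>\<open>s\<close> and \<open>t\<close> lie in \<open>B j\<close>, hence outside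
      \<open>D\<close> and \<open>D'\<close>; two neighbours in either set violate the girth
      condition.\<close>
    then show False using girth[OF D(2,3)] girth[OF D'(2,3)] dis by blast
  next
    case 2
    then have un: "unlinked l C" if "l \<in> I" for l using C(2) that by blast
    then obtain j k where jk: "C = {j, k}" "j \<noteq> k" using ii'(1) unfolding unlinked_def by blast
    have lt: "j < 5" "k < 5" using C(1)[OF ii'(1)] jk(1) by auto
    \<comment> \<open>Equality of sets fixes the pair only up to order, and the link condition is
      symmetric.\<close>
    have no: "\<not> (\<exists>q \<subseteq> A l. conn q \<and> card q \<le> 2 \<and> touch q (B j) \<and> touch q (B k))" if "l \<in> I" for l
    proof -
      have "unlinked l {j, k}" using un[OF that] jk(1) by simp
      then obtain j' k' where "{j, k} = {j', k'}"
        "\<not> (\<exists>q \<subseteq> A l. conn q \<and> card q \<le> 2 \<and> touch q (B j') \<and> touch q (B k'))"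
        unfolding unlinked_def by blast
      then show ?thesis by (auto simp: doubleton_eq_iff)
    qed
    have "\<exists>l\<in>I. \<exists>s\<in>A l. \<exists>t\<in>A l. (s = t \<or> E s t) \<and> touch {s} (B j) \<and> touch {t} (B k) \<and>
        (two_nbrs s (B j) \<or> two_nbrs t (B k))"
      by (rule short_connection[OF triangle_free theta_free B(1)[OF lt(1)] B(1)[OF lt(2)]
            B(2)[OF lt jk(2)] I(2)]) (use lt in \<open>simp_all add: A AB subsetD[OF I(1)]\<close>)
    then obtain l s t where l: "l \<in> I" and st: "s \<in> A l" "t \<in> A l" "s = t \<or> E s t"
      "touch {s} (B j)" "touch {t} (B k)" by blast
    have "conn {s, t}" using st(3) conn_edge conn_singleton by auto
    moreover have "card {s, t} \<le> 2" by (simp add: card_insert_if)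
    moreover have "touch {s, t} (B j)" "touch {s, t} (B k)" using st(4,5) by (auto simp: touch_def)
    ultimately have "\<exists>q \<subseteq> A l. conn q \<and> card q \<le> 2 \<and> touch q (B j) \<and> touch q (B k)"
      using st(1,2) by (intro exI[of _ "{s, t}"]) simp
    then show False using no[OF l] by contradiction
  qed
qed

end

section \<open>Translation between the adjacency relation and digraphs\<close>

section \<open>Induced subgraphs and branch sets\<close>

definition induce :: "'a pair_pre_digraph \<Rightarrow> 'a set \<Rightarrow> 'a pair_pre_digraph" where
  "induce G V = \<lparr>pverts = V, parcs = {(x, y) \<in> parcs G. x \<in> V \<and> y \<in> V}\<rparr>"

section \<open>Arc lists of vertex lists, the format of library walks and cycles\<close>

lemma set_vwalk_arcs: "set (vwalk_arcs p) = {(p ! i, p ! Suc i) | i. Suc i < length p}"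
proof (induction p rule: vwalk_arcs.induct)
  case (3 x y p)
  have "{((x # y # p) ! i, (x # y # p) ! Suc i) | i. Suc i < length (x # y # p)} =
    insert (x, y) {((y # p) ! i, (y # p) ! Suc i) | i. Suc i < length (y # p)}" (is "?L = ?R")
  proof (intro equalityI subsetI)
    fix e assume "e \<in> ?L"
    then obtain i where "Suc i < length (x # y # p)" "e = ((x # y # p) ! i, (x # y # p) ! Suc i)"
      by blast
    then show "e \<in> ?R" by (cases i) auto
  next
    fix e assume "e \<in> ?R"
    then consider "e = (x, y)"
      | i where "Suc i < length (y # p)" "e = ((y # p) ! i, (y # p) ! Suc i)" by blast
    then show "e \<in> ?L"
    proof cases
      case 1
      then show ?thesis by (auto intro!: exI[of _ 0])
    next
      case 2
      then show ?thesis by (auto intro!: exI[of _ "Suc i"])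
    qed
  qed
  then show ?case using 3 by simp
qed auto

lemma fst_vwalk_arcs: "fst ` set (vwalk_arcs p) = set (butlast p)"
  by (induction p rule: vwalk_arcs.induct) auto

lemma vwalk_arcs_snoc: "p \<noteq> [] \<Longrightarrow> set (vwalk_arcs (p @ [y])) = insert (last p, y) (set (vwalk_arcs p))"
  by (induction p rule: vwalk_arcs.induct) auto

lemma vwalk_arcs_Cons: "p \<noteq> [] \<Longrightarrow> set (vwalk_arcs (x # p)) = insert (x, hd p) (set (vwalk_arcs p))"
  by (cases p) auto

lemma cas_vwalk_arcs:
  "p \<noteq> [] \<Longrightarrow> pre_digraph.cas (with_proj H) (hd p) (vwalk_arcs p) (last p)"
  by (induction p rule: vwalk_arcs.induct) (auto simp: pre_digraph.cas.simps)

lemma awalk_verts_vwalk_arcs: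
  "p \<noteq> [] \<Longrightarrow> pre_digraph.awalk_verts (with_proj H) (hd p) (vwalk_arcs p) = p"
  by (induction p rule: vwalk_arcs.induct) (auto simp: pre_digraph.awalk_verts.simps)

context pair_graph
begin

sublocale adj: simple_adjacency "\<lambda>x y. (x, y) \<in> parcs G"
proof
  show "(x, y) \<in> parcs G \<Longrightarrow> (y, x) \<in> parcs G" for x y
    by (rule arcs_symmetric)
  show "(x, x) \<notin> parcs G" for x
    using no_loops by force
qed

lemma pair_graph_induce:
  assumes "V \<subseteq> pverts G"
  shows "pair_graph (induce G V)"
proof
  show "finite (pverts (induce G V))"
    using finite_subset[OF assms pair_finite_verts] by (simp add: induce_def)
  have "parcs (induce G V) \<subseteq> parcs G" by (auto simp: induce_def)
  then show "finite (parcs (induce G V))" using finite_subset pair_finite_arcs by blast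
  show "symmetric (with_proj (induce G V))"
    using adj.E_sym by (auto simp: symmetric_def induce_def intro!: symI)
qed (use adj.E_irrefl in \<open>auto simp: induce_def\<close>)

lemma induced_subgraph_induce:
  assumes "V \<subseteq> pverts G"
  shows "induced_subgraph (with_proj (induce G V)) (with_proj G)"
proof -
  interpret H: pair_graph "induce G V" using pair_graph_induce[OF assms] .
  have "wf_digraph (with_proj (induce G V))" "wf_digraph (with_proj G)" by unfold_locales
  then show ?thesis
    using assms by (auto simp: induced_subgraph_def subgraph_def compatible_def induce_def)
qed

lemma adj_verts: "(x, y) \<in> parcs G \<Longrightarrow> x \<in> pverts G \<and> y \<in> pverts G"
  using in_arcsD1 in_arcsD2 by auto

lemma ipath_arcs:
  assumes "adj.ipath p"
  shows "set (vwalk_arcs p) \<subseteq> parcs G"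
  using adj.ipathD(3)[OF assms] by (auto simp: set_vwalk_arcs)

text \<open>Inside each \<open>Q k\<close> take an induced path that meets the neighbourhoods of
  \<open>a\<close> and \<open>b\<close> only at its respective ends, and add \<open>a\<close> and
  \<open>b\<close>. Non-adjacency of \<open>a\<close> and \<open>b\<close> makes the extended paths
  chordless, and separation of the \<open>Q k\<close> excludes further edges.\<close>

lemma theta_of_config:
  assumes "adj.theta_config a b {..<3::nat} Q"
  shows "\<exists>V \<subseteq> pverts G. theta_graph (induce G V)"
proof -
  have ab: "a \<noteq> b" "(a, b) \<notin> parcs G" "(b, a) \<notin> parcs G"
    and Q: "\<And>k. k < 3 \<Longrightarrow> adj.conn (Q k) \<and> a \<notin> Q k \<and> b \<notin> Q k \<and>
      adj.touch {a} (Q k) \<and> adj.touch {b} (Q k)"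
    and sep: "\<And>i j. i < 3 \<Longrightarrow> j < 3 \<Longrightarrow> i \<noteq> j \<Longrightarrow> adj.sep (Q i) (Q j)"
    using assms adj.E_sym unfolding adj.theta_config_def by blast+
  have "\<exists>p. adj.ipath p \<and> set p \<subseteq> Q k \<and>
      (\<forall>i < length p. (a, p ! i) \<in> parcs G \<longleftrightarrow> i = 0) \<and>
      (\<forall>i < length p. (b, p ! i) \<in> parcs G \<longleftrightarrow> i = length p - 1)" if "k < 3" for k
  proof -
    have "\<exists>x\<in>Q k. (a, x) \<in> parcs G" "\<exists>x\<in>Q k. (b, x) \<in> parcs G"
      using Q[OF that] unfolding adj.touch_def by auto
    moreover have "adj.conn (Q k)" using Q[OF that] by blast
    ultimately obtain p where "adj.ipath p" "set p \<subseteq> Q k"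
      "\<And>i. i < length p \<Longrightarrow> (a, p ! i) \<in> parcs G \<longleftrightarrow> i = 0"
      "\<And>i. i < length p \<Longrightarrow> (b, p ! i) \<in> parcs G \<longleftrightarrow> i = length p - 1"
      using adj.induced_path_between[of "Q k" "\<lambda>x. (a, x) \<in> parcs G" "\<lambda>x. (b, x) \<in> parcs G"]
      by blast
    then show ?thesis by blast
  qed
  then have "\<forall>k. \<exists>p. k < 3 \<longrightarrow> adj.ipath p \<and> set p \<subseteq> Q k \<and>
      (\<forall>i < length p. (a, p ! i) \<in> parcs G \<longleftrightarrow> i = 0) \<and>
      (\<forall>i < length p. (b, p ! i) \<in> parcs G \<longleftrightarrow> i = length p - 1)" by blast
  from choice[OF this] obtain p where
    p: "\<And>k. k < 3 \<Longrightarrow> adj.ipath (p k)" "\<And>k. k < 3 \<Longrightarrow> set (p k) \<subseteq> Q k"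
    and pa: "\<And>k i. k < 3 \<Longrightarrow> i < length (p k) \<Longrightarrow> (a, p k ! i) \<in> parcs G \<longleftrightarrow> i = 0"
    and pb: "\<And>k i. k < 3 \<Longrightarrow> i < length (p k) \<Longrightarrow> (b, p k ! i) \<in> parcs G \<longleftrightarrow> i = length (p k) - 1"
    by blast
  have ne: "p k \<noteq> []" if "k < 3" for k using adj.ipathD(1)[OF p(1)[OF that]] .
  define P where "P k = a # p k @ [b]" for k
  have nin: "a \<notin> set (p k)" "b \<notin> set (p k)" if "k < 3" for k using Q[OF that] p(2)[OF that] by auto
  have ip: "adj.ipath (P k)" if k: "k < 3" for k
  proof -
    have "adj.ipath (p k @ [b])" using p(1)[OF k] nin[OF k] pb[OF k] by (intro adj.ipath_snoc)
    moreover have "(a, (p k @ [b]) ! i) \<in> parcs G \<longleftrightarrow> i = 0" if "i < length (p k @ [b])" for i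
    proof (cases "i < length (p k)")
      case False
      then have "i = length (p k)" using that by simp
      then have "i \<noteq> 0" "(p k @ [b]) ! i = b" using ne[OF k] by (simp_all add: nth_append)
      then show ?thesis using ab by simp
    qed (use pa[OF k] in \<open>simp add: nth_append\<close>)
    ultimately show ?thesis
      unfolding P_def using nin[OF k] ab by (intro adj.ipath_Cons) auto
  qed
  define V where "V = (\<Union>k<3. set (P k))"
  \<comment> \<open>The sets in \<open>simple_adjacency\<close> range over the whole type;
    membership in \<open>pverts G\<close> holds because every vertex of \<open>P k\<close> is the
    end of an arc.\<close>
  have V: "V \<subseteq> pverts G"
  proof
    fix x assume "x \<in> V"
    then obtain k i where k: "k < 3" "i < length (P k)" "x = P k ! i"
      unfolding V_def by (auto simp: in_set_conv_nth)
    show "x \<in> pverts G"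
    proof (cases i)
      case 0
      then have "(x, P k ! 1) \<in> parcs G"
        using adj.ipathD(3)[OF ip[OF k(1)], of i 1] k ne[OF k(1)] by (auto simp: P_def)
      then show ?thesis using adj_verts by blast
    next
      case (Suc j)
      then have "(x, P k ! j) \<in> parcs G"
        using adj.ipathD(3)[OF ip[OF k(1)], of i j] k by auto
      then show ?thesis using adj_verts by blast
    qed
  qed
  let ?H = "induce G V"
  have PV: "set (P k) \<subseteq> V" if "k < 3" for k using that by (auto simp: V_def)
  have "vpath (P k) (with_proj ?H) \<and> hd (P k) = a \<and> last (P k) = b \<and>
      2 \<le> vwalk_length (P k) \<and> chordless (P k) ?H" if k: "k < 3" for k
  proof (intro conjI)
    have "set (vwalk_arcs (P k)) \<subseteq> parcs ?H"
      using ipath_arcs[OF ip[OF k]] PV[OF k] by (auto simp: induce_def set_vwalk_arcs)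
    then show "vpath (P k) (with_proj ?H)"
      using PV[OF k] adj.ipathD[OF ip[OF k]]
      by (auto simp: vpath_def vwalk_def induce_def P_def)
    show "2 \<le> vwalk_length (P k)" using ne[OF k] by (cases "p k") (auto simp: P_def)
    show "chordless (P k) ?H"
      using adj.ipathD(3)[OF ip[OF k]] by (auto simp: chordless_def induce_def)
  qed (auto simp: P_def)
  moreover have "set (P i) \<inter> set (P j) = {a, b}" if "i < 3" "j < 3" "i \<noteq> j" for i j
    using sep[OF that] p(2)[OF that(1)] p(2)[OF that(2)] by (auto simp: P_def adj.sep_def)
  moreover have "\<exists>k < 3. {x, y} = {a, P k ! 1} \<or> {x, y} = {last (butlast (P k)), b}"
    if ij: "i < 3" "j < 3" "i \<noteq> j" and x: "x \<in> set (P i)" and y: "y \<in> set (P j)"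
      and xy: "(x, y) \<in> parcs ?H" for i j x y
  proof -
    have e: "(x, y) \<in> parcs G" "(y, x) \<in> parcs G" using xy adj.E_sym by (auto simp: induce_def)
    have first: "{a, z} = {a, P k ! 1}" if "(a, z) \<in> parcs G" "z \<in> set (P k)" "k < 3" for k z
    proof -
      have "z \<in> set (p k)" using that ab adj.E_irrefl by (auto simp: P_def)
      then obtain l where l: "l < length (p k)" "z = p k ! l" by (auto simp: in_set_conv_nth)
      then have "z = p k ! 0" using pa[OF that(3)] that(1) by auto
      then show ?thesis using ne[OF that(3)] by (simp add: P_def nth_append)
    qed
    have lst: "{b, z} = {last (butlast (P k)), b}" if "(b, z) \<in> parcs G" "z \<in> set (P k)" "k < 3" for k z
    proof -
      have "z \<in> set (p k)" using that ab adj.E_irrefl by (auto simp: P_def)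
      then obtain l where l: "l < length (p k)" "z = p k ! l" by (auto simp: in_set_conv_nth)
      then have "z = p k ! (length (p k) - 1)" using pb[OF that(3)] that(1) by auto
      then have "z = last (p k)" using ne[OF that(3)] by (simp add: last_conv_nth)
      moreover have "butlast (P k) = a # p k" by (simp add: P_def butlast_append)
      ultimately show ?thesis using ne[OF that(3)] by auto
    qed
    consider "x = a" | "x = b" | "y = a" | "y = b" | "x \<in> set (p i)" "y \<in> set (p j)"
      using x y by (auto simp: P_def)
    then show ?thesis
    proof cases
      case 1
      then show ?thesis using first[of y j] e y ij(2) by blast
    next
      case 2
      then show ?thesis using lst[of y j] e y ij(2) by blast
    next
      case 3
      then have "{x, y} = {a, P i ! 1}" using first[of x i] e x ij(1) by (simp add: insert_commute)
      then show ?thesis using ij(1) by blast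
    next
      case 4
      then have "{x, y} = {last (butlast (P i)), b}"
        using lst[of x i] e x ij(1) by (simp add: insert_commute)
      then show ?thesis using ij(1) by blast
    next
      case 5
      then have False
        using sep[OF ij] p(2)[OF ij(1)] p(2)[OF ij(2)] e(1) unfolding adj.sep_def adj.touch_def by blast
      then show ?thesis ..
    qed
  qed
  moreover have "pverts ?H = (\<Union>k<3. set (P k))" by (simp add: induce_def V_def)
  ultimately have "theta_graph ?H"
    unfolding theta_graph_def using pair_graph_induce[OF V]
    by (intro conjI exI[of _ a] exI[of _ b] exI[of _ P]) simp_all
  then show ?thesis using V by blast
qed

text \<open>A shortest induced path in \<open>D\<close> between two distinct neighbours of
  \<open>s\<close> contains no third neighbour, so closing it through \<open>s\<close> gives an
  induced cycle with one vertex more than the path.\<close>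

lemma cycle_of_two_nbrs:
  assumes "adj.conn D" "s \<notin> D" "adj.two_nbrs s D"
  shows "\<exists>V \<subseteq> pverts G. \<exists>n \<le> Suc (card D). cycle_graph n (induce G V)"
proof -
  define good where "good p \<longleftrightarrow> adj.ipath p \<and> set p \<subseteq> D \<and> 2 \<le> length p \<and>
      (s, hd p) \<in> parcs G \<and> (s, last p) \<in> parcs G" for p
  obtain u v where uv: "u \<in> D" "v \<in> D" "u \<noteq> v" "(s, u) \<in> parcs G" "(s, v) \<in> parcs G"
    using assms(3) unfolding adj.two_nbrs_def by blast
  obtain p0 where p0: "adj.ipath p0" "set p0 \<subseteq> D" "\<And>i. i < length p0 \<Longrightarrow> p0 ! i = u \<longleftrightarrow> i = 0"
      "\<And>i. i < length p0 \<Longrightarrow> p0 ! i = v \<longleftrightarrow> i = length p0 - 1"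
    using adj.induced_path_between[OF assms(1), of "\<lambda>x. x = u" "\<lambda>x. x = v"] uv by blast
  have "p0 \<noteq> []" using adj.ipathD(1)[OF p0(1)] .
  then have "hd p0 = u" "last p0 = v" using p0(3)[of 0] p0(4)[of "length p0 - 1"]
    by (auto simp: hd_conv_nth last_conv_nth)
  moreover from this have "2 \<le> length p0" using uv(3) \<open>p0 \<noteq> []\<close> by (cases p0; cases "tl p0") auto
  ultimately have "good p0" using p0 uv by (simp add: good_def)
  then obtain p where p: "good p" and min: "\<And>q. good q \<Longrightarrow> length p \<le> length q"
    using arg_min_nat_lemma[of good p0 length] by blast
  have ip: "adj.ipath p" "set p \<subseteq> D" "2 \<le> length p" "(s, hd p) \<in> parcs G" "(s, last p) \<in> parcs G"
    using p by (auto simp: good_def)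
  have ne: "p \<noteq> []" and dist: "distinct p" using adj.ipathD[OF ip(1)] by auto
  have nbr: "x = hd p \<or> x = last p" if x: "x \<in> set p" "(s, x) \<in> parcs G" for x
  proof (rule ccontr)
    assume "\<not> ?thesis"
    moreover obtain i where i: "i < length p" "x = p ! i" using x(1) by (auto simp: in_set_conv_nth)
    ultimately have "i \<noteq> 0" "i \<noteq> length p - 1"
      using ne hd_conv_nth[of p] last_conv_nth[of p] by metis+
    \<comment> \<open>\<open>0 < i\<close> keeps two vertices in the path cut off at
      \<open>x\<close>, and \<open>Suc i < length p\<close> makes it shorter than
      \<open>p\<close>.\<close>
    then have i': "0 < i" "Suc i < length p" using i by auto
    have "last (take (Suc i) p) = x" using i by (simp add: take_Suc_conv_app_nth)
    then have "good (take (Suc i) p)"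
      unfolding good_def using adj.ipath_take[OF ip(1)] set_take_subset[of "Suc i" p] ip i' x(2)
      by auto
    then show False using min[of "take (Suc i) p"] i' by simp
  qed
  have s: "s \<notin> set p" using ip(2) assms(2) by blast
  define V where "V = insert s (set p)"
  have V: "V \<subseteq> pverts G"
  proof -
    have "x \<in> pverts G" if x: "x \<in> set p" for x
    proof -
      obtain i where i: "i < length p" "x = p ! i" using x by (auto simp: in_set_conv_nth)
      have "\<exists>j < length p. (p ! i, p ! j) \<in> parcs G"
      proof (cases i)
        case 0
        then show ?thesis using adj.ipathD(3)[OF ip(1), of 0 1] ip(3) ne by (intro exI[of _ 1]) auto
      next
        case (Suc j)
        then show ?thesis using adj.ipathD(3)[OF ip(1), of i j] i by (intro exI[of _ j]) auto
      qed
      then show ?thesis using i adj_verts by blast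
    qed
    then show ?thesis using ip(4) adj_verts unfolding V_def by blast
  qed
  let ?H = "induce G V"
  define c where "c = vwalk_arcs (s # p @ [s])"
  have set_c: "set c = insert (s, hd p) (insert (last p, s) (set (vwalk_arcs p)))"
    unfolding c_def using ne by (simp add: vwalk_arcs_Cons vwalk_arcs_snoc)
  have arcs: "parcs ?H = set c \<union> (set c)\<inverse>"
  proof (intro equalityI subsetI)
    fix e assume "e \<in> parcs ?H"
    then obtain x y where e: "e = (x, y)" "(x, y) \<in> parcs G" "x \<in> V" "y \<in> V"
      by (auto simp: induce_def)
    have e': "(y, x) \<in> parcs G" using adj.E_sym[OF e(2)] .
    consider "x = s" "y \<in> set p" | "y = s" "x \<in> set p" | "x \<in> set p" "y \<in> set p"
      using e adj.E_irrefl unfolding V_def by blast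
    then show "e \<in> set c \<union> (set c)\<inverse>"
    proof cases
      case 1
      then show ?thesis using nbr e by (auto simp: set_c)
    next
      case 2
      then show ?thesis using nbr e e' by (auto simp: set_c)
    next
      case 3
      then obtain i j where ij: "i < length p" "x = p ! i" "j < length p" "y = p ! j"
        by (auto simp: in_set_conv_nth)
      then have "i = Suc j \<or> j = Suc i" using adj.ipathD(3)[OF ip(1) ij(1,3)] e(2) by simp
      then have "(x, y) \<in> set (vwalk_arcs p) \<or> (y, x) \<in> set (vwalk_arcs p)"
        using ij unfolding set_vwalk_arcs by auto
      then show ?thesis using e(1) by (auto simp: set_c)
    qed
  next
    have "set (vwalk_arcs p) \<subseteq> set p \<times> set p" by (auto simp: set_vwalk_arcs)
    then have "set c \<subseteq> parcs ?H"
      using ipath_arcs[OF ip(1)] ip(4) adj.E_sym[OF ip(5)] ne by (auto simp: set_c induce_def V_def)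
    moreover have "(set c)\<inverse> \<subseteq> parcs ?H"
      using calculation adj.E_sym by (auto simp: induce_def)
    ultimately show "e \<in> set c \<union> (set c)\<inverse> \<Longrightarrow> e \<in> parcs ?H" for e by blast
  qed
  have len: "length c = Suc (length p)"
    unfolding c_def vwalk_length_def[symmetric] by simp
  have "pre_digraph.cas (with_proj ?H) s c s"
    using cas_vwalk_arcs[of "s # p @ [s]" ?H] by (simp add: c_def)
  moreover have "pre_digraph.awalk_verts (with_proj ?H) s c = s # p @ [s]"
    using awalk_verts_vwalk_arcs[of "s # p @ [s]" ?H] by (simp add: c_def)
  moreover have "set c \<subseteq> parcs ?H" using arcs by blast
  moreover have "c \<noteq> []" using len by auto
  ultimately have "pre_digraph.cycle (with_proj ?H) c"
    unfolding pre_digraph.cycle_def pre_digraph.awalk_def using s dist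
    by (intro exI[of _ s]) (simp add: induce_def V_def)
  moreover have "fst ` set c = V"
    unfolding c_def fst_vwalk_arcs V_def by (simp add: butlast_append)
  ultimately have "cycle_graph (Suc (length p)) ?H"
    unfolding cycle_graph_def using pair_graph_induce[OF V] ip(3) len arcs
    by (auto simp: induce_def intro!: exI[of _ c])
  moreover have "length p \<le> card D"
    using card_mono[OF adj.connD(1)[OF assms(1)] ip(2)] distinct_card[OF dist] by simp
  ultimately show ?thesis using V by blast
qed

text \<open>The branch sets of the minor: singletons at the start, unchanged by a deletion, and
  united for \<open>u\<close> and \<open>v\<close> by a contraction, where the edge keeps the union
  connected.\<close>

lemma induced_minor_model:
  assumes "induced_minor M G"
  shows "\<exists>\<phi>. (\<forall>x\<in>pverts M. adj.conn (\<phi> x)) \<and>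
    (\<forall>x\<in>pverts M. \<forall>y\<in>pverts M. x \<noteq> y \<longrightarrow>
       \<phi> x \<inter> \<phi> y = {} \<and> ((x, y) \<in> parcs M \<longleftrightarrow> adj.touch (\<phi> x) (\<phi> y)))"
proof -
  define model where "model M \<phi> \<longleftrightarrow> (\<forall>x\<in>pverts M. adj.conn (\<phi> x)) \<and>
    (\<forall>x\<in>pverts M. \<forall>y\<in>pverts M. x \<noteq> y \<longrightarrow>
       \<phi> x \<inter> \<phi> y = {} \<and> ((x, y) \<in> parcs M \<longleftrightarrow> adj.touch (\<phi> x) (\<phi> y)))" for M :: "'a pair_pre_digraph" and \<phi>
  \<comment> \<open>The second argument is generalised to \<open>G'\<close> with an equation, as
    \<open>G\<close> is fixed by the locale. Well-formedness of the arcs is carried along because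
    the contraction step needs \<open>u\<close> and \<open>v\<close> to be distinct
    vertices.\<close>
  have "(\<forall>(x, y)\<in>parcs M. x \<in> pverts M \<and> y \<in> pverts M \<and> x \<noteq> y) \<and> (\<exists>\<phi>. model M \<phi>)"
    if "induced_minor M G'" "G' = G" for M G'
    using that
  proof induction
    case (refl G')
    then have "model G' (\<lambda>x. {x})"
      by (auto simp: model_def adj.conn_singleton adj.touch_def)
    then show ?case using refl adj_verts adj.E_irrefl by blast
  next
    case (delete H G' v)
    then obtain \<phi> where "model H \<phi>" by blast
    then have "model (delete_vertex H v) \<phi>"
      by (auto simp: model_def delete_vertex_def)
    then show ?case using delete by (auto simp: delete_vertex_def)
  next
    case (contract H G' u v)
    then obtain \<phi> where \<phi>: "model H \<phi>"
      and wf: "\<And>x y. (x, y) \<in> parcs H \<Longrightarrow> x \<in> pverts H \<and> y \<in> pverts H \<and> x \<noteq> y" by blast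
    have uv: "u \<in> pverts H" "v \<in> pverts H" "u \<noteq> v" using wf[OF contract.hyps(2)] by auto
    have conn: "adj.conn (\<phi> x)" if "x \<in> pverts H" for x using \<phi> that by (simp add: model_def)
    have disj: "\<phi> x \<inter> \<phi> y = {}" and arc: "(x, y) \<in> parcs H \<longleftrightarrow> adj.touch (\<phi> x) (\<phi> y)"
      if "x \<in> pverts H" "y \<in> pverts H" "x \<noteq> y" for x y
      using \<phi> that by (auto simp: model_def)
    let ?C = "contract_edge H u v"
    have C: "pverts ?C = pverts H - {v}"
      "parcs ?C = {(if x = v then u else x, if y = v then u else y) | x y. (x, y) \<in> parcs H \<and>
         (if x = v then u else x) \<noteq> (if y = v then u else y)}"
      by (simp_all add: contract_edge_def Let_def)
    define \<psi> where "\<psi> = \<phi>(u := \<phi> u \<union> \<phi> v)"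
    have \<psi>: "\<psi> u = \<phi> u \<union> \<phi> v" "\<And>x. x \<noteq> u \<Longrightarrow> \<psi> x = \<phi> x" by (auto simp: \<psi>_def)
    have conn_u: "adj.conn (\<phi> u \<union> \<phi> v)"
      using adj.conn_Un[OF conn[OF uv(1)] conn[OF uv(2)]] arc[OF uv] contract.hyps(2) by blast
    have parcs_u: "(u, y) \<in> parcs ?C \<longleftrightarrow> (u, y) \<in> parcs H \<or> (v, y) \<in> parcs H"
      "(y, u) \<in> parcs ?C \<longleftrightarrow> (y, u) \<in> parcs H \<or> (y, v) \<in> parcs H"
      if "y \<noteq> u" "y \<noteq> v" for y
      using that uv(3) unfolding C by (auto split: if_splits; metis)+
    have parcs_other: "(x, y) \<in> parcs ?C \<longleftrightarrow> (x, y) \<in> parcs H"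
      if "x \<noteq> u" "y \<noteq> u" "x \<noteq> v" "y \<noteq> v" "x \<noteq> y" for x y
      using that uv(3) unfolding C by (auto split: if_splits)
    have touch_Un: "adj.touch (A \<union> B) D \<longleftrightarrow> adj.touch A D \<or> adj.touch B D"
      "adj.touch D (A \<union> B) \<longleftrightarrow> adj.touch D A \<or> adj.touch D B" for A B D
      unfolding adj.touch_def by blast+
    have "model ?C \<psi>"
      unfolding model_def
    proof (intro conjI ballI impI)
      fix x assume x: "x \<in> pverts ?C"
      show "adj.conn (\<psi> x)" using x conn conn_u by (cases "x = u") (auto simp: C \<psi>)
      fix y assume y: "y \<in> pverts ?C" and ne: "x \<noteq> y"
      have xy: "x \<in> pverts H" "y \<in> pverts H" "x \<noteq> v" "y \<noteq> v" using x y by (auto simp: C)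
      show "\<psi> x \<inter> \<psi> y = {}"
        using disj xy uv ne by (cases "x = u"; cases "y = u") (auto simp: \<psi>)
      show "(x, y) \<in> parcs ?C \<longleftrightarrow> adj.touch (\<psi> x) (\<psi> y)"
        using arc xy uv ne by (cases "x = u"; cases "y = u") (auto simp: \<psi> parcs_u parcs_other touch_Un)
    qed
    moreover have "\<forall>(x, y)\<in>parcs ?C. x \<in> pverts ?C \<and> y \<in> pverts ?C \<and> x \<noteq> y"
      using wf uv by (auto simp: C)
    ultimately show ?case by blast
  qed
  from this[OF assms HOL.refl] show ?thesis unfolding model_def by blast
qed

end

theorem theorem1p2:
  fixes G :: "'a pair_pre_digraph"
  assumes "pair_graph G"
    and "\<exists>M. induced_minor M G \<and> K\<^bsub>134,12\<^esub> (with_proj M)"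
  shows "\<exists>H. induced_subgraph (with_proj H) (with_proj G) \<and>
             ((\<exists>n \<le> 12. cycle_graph n H) \<or> theta_graph H)"
proof (rule ccontr)
  assume no: "\<not> ?thesis"
  interpret pair_graph G by fact
  have no_cycle: "\<not> cycle_graph n (induce G V)" if "V \<subseteq> pverts G" "n \<le> 12" for V n
    using no induced_subgraph_induce[OF that(1)] that(2) by blast
  have no_theta: "\<not> theta_graph (induce G V)" if "V \<subseteq> pverts G" for V
    using no induced_subgraph_induce[OF that] by blast
  obtain M where M: "induced_minor M G" "K\<^bsub>134,12\<^esub> (with_proj M)" using assms(2) by blast
  obtain U W where UW: "pverts M = U \<union> W" "U \<inter> W = {}" "card U = 134" "card W = 12"
      "parcs M = U \<times> W \<union> W \<times> U"
    using M(2) unfolding complete_bipartite_digraph_pair_def by blast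
  obtain \<phi> where conn: "\<And>x. x \<in> pverts M \<Longrightarrow> adj.conn (\<phi> x)"
    and model: "\<And>x y. x \<in> pverts M \<Longrightarrow> y \<in> pverts M \<Longrightarrow> x \<noteq> y \<Longrightarrow>
       \<phi> x \<inter> \<phi> y = {} \<and> ((x, y) \<in> parcs M \<longleftrightarrow> adj.touch (\<phi> x) (\<phi> y))"
    using induced_minor_model[OF M(1)] by blast
  have sep: "adj.sep (\<phi> x) (\<phi> y)" if "x \<in> U \<and> y \<in> U \<or> x \<in> W \<and> y \<in> W" "x \<noteq> y" for x y
    using model[of x y] that UW unfolding adj.sep_def by blast
  have touch: "\<phi> x \<inter> \<phi> y = {} \<and> adj.touch (\<phi> x) (\<phi> y)" if "x \<in> U" "y \<in> W" for x y
    using model[of x y] that UW by blast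
  \<comment> \<open>Five branch sets of the side \<open>W\<close> become the \<open>B j\<close>; the
    branch sets of \<open>U\<close> become the \<open>A i\<close>.\<close>
  obtain W' where W': "W' \<subseteq> W" "card W' = 5" "finite W'"
    using obtain_subset_with_card_n[of 5 W] UW(4) by auto
  then obtain h where h: "bij_betw h {..<5::nat} W'"
    using ex_bij_betw_nat_finite[of W'] by (auto simp: atLeast0LessThan)
  have hW: "h j \<in> W" if "j < 5" for j using h W'(1) that by (auto simp: bij_betw_def)
  have h_inj: "h j \<noteq> h k" if "j < 5" "k < 5" "j \<noteq> k" for j k
    using h that by (auto simp: bij_betw_def inj_on_def)
  show False
  proof (rule adj.biclique_model_contradiction[of U \<phi> "\<phi> \<circ> h"])
    \<comment> \<open>Two neighbours of \<open>s\<close> in \<open>D\<close> would close an induced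
      cycle of length at most \<open>Suc 4\<close>.\<close>
    fix D s assume D: "adj.conn D" "card D \<le> 4" "s \<notin> D"
    show "\<not> adj.two_nbrs s D"
    proof
      assume "adj.two_nbrs s D"
      then obtain V n where "V \<subseteq> pverts G" "n \<le> Suc (card D)" "cycle_graph n (induce G V)"
        using cycle_of_two_nbrs[OF D(1,3)] by blast
      then show False using no_cycle[of V n] D(2) by simp
    qed
  next
    show "\<nexists>a b Q. adj.theta_config a b {..<3::nat} Q"
      using theta_of_config no_theta by blast
  next
    show "finite U" "64 < card U" using UW(3) card.infinite by fastforce+
  next
    fix x assume "x \<in> U"
    then show "adj.conn (\<phi> x)" using conn UW(1) by blast
  next
    fix j :: nat assume "j < 5"
    then show "adj.conn ((\<phi> \<circ> h) j)" using conn[of "h j"] hW[of j] UW(1) by simp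
  next
    fix j k :: nat assume "j < 5" "k < 5" "j \<noteq> k"
    then show "adj.sep ((\<phi> \<circ> h) j) ((\<phi> \<circ> h) k)" using sep[of "h j" "h k"] hW h_inj by simp
  next
    fix x y assume "x \<in> U" "y \<in> U" "x \<noteq> y"
    then show "adj.sep (\<phi> x) (\<phi> y)" using sep by blast
  next
    fix x and j :: nat assume "x \<in> U" "j < 5"
    then show "\<phi> x \<inter> (\<phi> \<circ> h) j = {}" "adj.touch (\<phi> x) ((\<phi> \<circ> h) j)"
      using touch[of x "h j"] hW[of j] by simp_all
  qed
qed

end
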